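(* (Strong Knudsen's law.) Let $0<\alpha<\pi/6$ with $\alpha/2\pi$ irrational, and let $K$ be the transition probability kernel on $[0,\pi]$ defined in the context. Let $\nu$ be any probability measure on $\mathcal{B}([0,\pi])$ that is absolutely continuous with respect to Lebesgue measure, and define $\nu^{(0)}=\nu$ and $\nu^{(n+1)}(A)=\int_{[0,\pi]}K(\theta,A)\,d\nu^{(n)}(\theta)$ for $n\ge0$ and $A\in\mathcal{B}([0,\pi])$. Then for every $A\in\mathcal{B}([0,\pi])$, $$\lim_{n\to\infty}\nu^{(n)}(A)=\frac12\int_A\sin(\theta)\,d\theta .$$
   Context: Let $0<\alpha<\pi/6$. Put $u_{\beta}(\theta)=\frac12\left(1+\frac{\tan\beta}{\tan\theta}\right)$ (with $1/\tan(\theta)=\cot(\theta)$, so that it equals $0$ at $\theta=\pi/2$). Define maps on $[0,\pi]$ with values in $\mathbb{R}$: $\tau_1(\theta)=\theta+2\alpha$, $\tau_2(\theta)=-\theta+2\pi-4\alpha$, $\tau_3(\theta)=\theta-2\alpha$, $\tau_4(\theta)=-\theta+4\alpha$. Define $p_1,\dots,p_4:[0,\pi]\to[0,1]$ by: $p_1(\theta)=1$ on $[0,\alpha)$, $u_\alpha(\theta)$ on $[\alpha,\pi-3\alpha)$, $2\cos(2\alpha)u_{2\alpha}(\theta)$ on $[\pi-3\alpha,\pi-2\alpha)$, $0$ on $[\pi-2\alpha,\pi]$; $p_2(\theta)=0$ on $[0,\pi-3\alpha)$, $u_\alpha(\theta)-2\cos(2\alpha)u_{2\alpha}(\theta)$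 on $[\pi-3\alpha,\pi-2\alpha)$, $u_\alpha(\theta)$ on $[\pi-2\alpha,\pi-\alpha)$, $0$ on $[\pi-\alpha,\pi]$; $p_3(\theta)=0$ on $[0,2\alpha)$, $2\cos(2\alpha)u_{2\alpha}(-\theta)$ on $[2\alpha,3\alpha)$, $u_\alpha(-\theta)$ on $[3\alpha,\pi-\alpha)$, $1$ on $[\pi-\alpha,\pi]$; $p_4(\theta)=0$ on $[0,\alpha)$, $u_\alpha(-\theta)$ on $[\alpha,2\alpha)$, $u_\alpha(-\theta)-2\cos(2\alpha)u_{2\alpha}(-\theta)$ on $[2\alpha,3\alpha)$, $0$ on $[3\alpha,\pi]$. One has $\sum_k p_k=1$, and $\tau_k(\theta)\in[0,\pi]$ whenever $p_k(\theta)>0$. The transition kernel is $K(\theta,A)=\sum_{i=1}^{4}p_i(\theta)\mathbf{1}_A(\tau_i(\theta))$ for $\theta\in[0,\pi]$, $A\in\mathcal{B}([0,\pi])$. It describes the random outgoing angle of a particle entering, at a uniformly random point of the open side, a triangular billiard cell with angle $\alpha$. Angles are measured in $[0,\pi]$ with respect to the open side, so the cosine law takes the form of a sine density. *)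

theory Defs
  imports "HOL-Probability.Probability"
begin

(* cot is cos / sin, so tan b / tan t is rendered as tan b * cot t, which vanishes at t = pi / 2. *)
definition u :: "real \<Rightarrow> real \<Rightarrow> real" where
  "u \<beta> \<theta> = 1/2 * (1 + tan \<beta> * cot \<theta>)"

definition tau1 :: "real \<Rightarrow> real \<Rightarrow> real" where
  "tau1 \<alpha> \<theta> = \<theta> + 2*\<alpha>"

definition tau2 :: "real \<Rightarrow> real \<Rightarrow> real" where
  "tau2 \<alpha> \<theta> = - \<theta> + 2*pi - 4*\<alpha>"

definition tau3 :: "real \<Rightarrow> real \<Rightarrow> real" where
  "tau3 \<alpha> \<theta> = \<theta> - 2*\<alpha>"

definition tau4 :: "real \<Rightarrow> real \<Rightarrow> real" where
  "tau4 \<alpha> \<theta> = - \<theta> + 4*\<alpha>"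

(* The functions p1, ..., p4 and the kernel K are meaningful for t in {0..pi} only. *)
definition p1 :: "real \<Rightarrow> real \<Rightarrow> real" where
  "p1 \<alpha> \<theta> =
    (if \<theta> < \<alpha> then 1
     else if \<theta> < pi - 3*\<alpha> then u \<alpha> \<theta>
     else if \<theta> < pi - 2*\<alpha> then 2 * cos (2*\<alpha>) * u (2*\<alpha>) \<theta>
     else 0)"

definition p2 :: "real \<Rightarrow> real \<Rightarrow> real" where
  "p2 \<alpha> \<theta> =
    (if \<theta> < pi - 3*\<alpha> then 0
     else if \<theta> < pi - 2*\<alpha> then u \<alpha> \<theta> - 2 * cos (2*\<alpha>) * u (2*\<alpha>) \<theta>
     else if \<theta> < pi - \<alpha> then u \<alpha> \<theta>
     else 0)"

definition p3 :: "real \<Rightarrow> real \<Rightarrow> real" where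
  "p3 \<alpha> \<theta> =
    (if \<theta> < 2*\<alpha> then 0
     else if \<theta> < 3*\<alpha> then 2 * cos (2*\<alpha>) * u (2*\<alpha>) (- \<theta>)
     else if \<theta> < pi - \<alpha> then u \<alpha> (- \<theta>)
     else 1)"

definition p4 :: "real \<Rightarrow> real \<Rightarrow> real" where
  "p4 \<alpha> \<theta> =
    (if \<theta> < \<alpha> then 0
     else if \<theta> < 2*\<alpha> then u \<alpha> (- \<theta>)
     else if \<theta> < 3*\<alpha> then u \<alpha> (- \<theta>) - 2 * cos (2*\<alpha>) * u (2*\<alpha>) (- \<theta>)
     else 0)"

definition K :: "real \<Rightarrow> real \<Rightarrow> real set \<Rightarrow> real" where
  "K \<alpha> \<theta> A =
     p1 \<alpha> \<theta> * indicator A (tau1 \<alpha> \<theta>) + p2 \<alpha> \<theta> * indicator A (tau2 \<alpha> \<theta>)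
   + p3 \<alpha> \<theta> * indicator A (tau3 \<alpha> \<theta>) + p4 \<alpha> \<theta> * indicator A (tau4 \<alpha> \<theta>)"

(* measure_of yields the null measure if the given set function is not a measure;
   emeasure_kernel_step below excludes this. *)
definition kernel_step :: "real \<Rightarrow> real measure \<Rightarrow> real measure" where
  "kernel_step \<alpha> M =
     measure_of {0..pi} (sets (restrict_space borel {0..pi}))
       (\<lambda>A. \<integral>\<^sup>+ \<theta>. ennreal (K \<alpha> \<theta> A) \<partial>M)"

primrec kernel_iterate :: "real \<Rightarrow> real measure \<Rightarrow> nat \<Rightarrow> real measure" where
  "kernel_iterate \<alpha> \<nu> 0 = \<nu>"
| "kernel_iterate \<alpha> \<nu> (Suc n) = kernel_step \<alpha> (kernel_iterate \<alpha> \<nu> n)"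

lemma sets_restrict_Icc_sigma:
  "sigma_sets {0..pi} (sets (restrict_space borel {0..pi})) = sets (restrict_space borel {0..pi})"
  using sets.sigma_sets_eq[of "restrict_space borel {0..pi}"]
  by (simp add: space_restrict_space)

lemma sets_restrict_Icc_Pow: "sets (restrict_space borel {0..pi}) \<subseteq> Pow {0..pi}"
  using sets.space_closed[of "restrict_space borel {0..pi}"]
  by (simp add: space_restrict_space)

lemma space_kernel_step: "space (kernel_step \<alpha> M) = {0..pi}"
  unfolding kernel_step_def by (rule space_measure_of[OF sets_restrict_Icc_Pow])

lemma sets_kernel_step: "sets (kernel_step \<alpha> M) = sets (restrict_space borel {0..pi})"
  unfolding kernel_step_def
  by (simp add: sets_measure_of[OF sets_restrict_Icc_Pow] sets_restrict_Icc_sigma)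

lemma u_eq:
  assumes "cos \<beta> \<noteq> 0" "sin \<theta> \<noteq> 0"
  shows "u \<beta> \<theta> = sin (\<theta> + \<beta>) / (2 * cos \<beta> * sin \<theta>)"
  using assms by (simp add: u_def tan_def cot_def sin_add field_simps)

lemma u_minus_eq:
  assumes "cos \<beta> \<noteq> 0" "sin \<theta> \<noteq> 0"
  shows "u \<beta> (- \<theta>) = sin (\<theta> - \<beta>) / (2 * cos \<beta> * sin \<theta>)"
  using assms by (simp add: u_def tan_def cot_def sin_diff field_simps)

lemma p_nonneg:
  assumes \<alpha>: "0 < \<alpha>" "\<alpha> < pi/6" and \<theta>: "\<theta> \<in> {0..pi}"
  shows "0 \<le> p1 \<alpha> \<theta>" "0 \<le> p2 \<alpha> \<theta>" "0 \<le> p3 \<alpha> \<theta>" "0 \<le> p4 \<alpha> \<theta>"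
proof -
  have c1: "0 < cos \<alpha>" and c2: "0 < cos (2*\<alpha>)"
    using \<alpha> by (auto intro!: cos_gt_zero_pi)
  have s: "0 < sin \<theta>" if "\<alpha> \<le> \<theta>" "\<theta> < pi" for \<theta>
    using that \<alpha> by (intro sin_gt_zero) auto
  have up: "0 \<le> u \<alpha> \<theta>" if "\<alpha> \<le> \<theta>" "\<theta> < pi - \<alpha>" for \<theta>
    using that \<alpha> c1 s[of \<theta>] by (auto simp: u_eq intro!: divide_nonneg_pos sin_ge_zero)
  have um: "0 \<le> u \<alpha> (-\<theta>)" if "\<alpha> \<le> \<theta>" "\<theta> < pi - \<alpha>" for \<theta>
    using that \<alpha> c1 s[of \<theta>] by (auto simp: u_minus_eq intro!: divide_nonneg_pos sin_ge_zero)
  have vp: "0 \<le> u (2*\<alpha>) \<theta>" if "\<alpha> \<le> \<theta>" "\<theta> < pi - 2*\<alpha>" for \<theta>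
    using that \<alpha> c2 s[of \<theta>] by (auto simp: u_eq intro!: divide_nonneg_pos sin_ge_zero)
  have vm: "0 \<le> u (2*\<alpha>) (-\<theta>)" if "2*\<alpha> \<le> \<theta>" "\<theta> < pi - 2*\<alpha>" for \<theta>
    using that \<alpha> c2 s[of \<theta>] by (auto simp: u_minus_eq intro!: divide_nonneg_pos sin_ge_zero)
  have prod_p: "2 * cos \<alpha> * sin (\<theta> + 2*\<alpha>) = sin (\<theta> + 3*\<alpha>) + sin (\<theta> + \<alpha>)" for \<theta>
    using sin_times_cos[of "\<theta> + 2*\<alpha>" \<alpha>] by (simp add: algebra_simps)
  have dp: "0 \<le> u \<alpha> \<theta> - 2 * cos (2*\<alpha>) * u (2*\<alpha>) \<theta>"
    if t: "pi - 3*\<alpha> \<le> \<theta>" "\<theta> < pi - 2*\<alpha>" for \<theta>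
  proof -
    have st: "0 < sin \<theta>" using t \<alpha> by (intro s) auto
    have "0 \<le> sin (\<theta> + 3*\<alpha> - pi)" using t \<alpha> by (intro sin_ge_zero) auto
    then have neg: "sin (\<theta> + 3*\<alpha>) \<le> 0" by (simp add: sin_diff)
    have "u \<alpha> \<theta> - 2 * cos (2*\<alpha>) * u (2*\<alpha>) \<theta>
        = (sin (\<theta> + \<alpha>) - 2 * cos \<alpha> * sin (\<theta> + 2*\<alpha>)) / (2 * cos \<alpha> * sin \<theta>)"
      using c1 c2 st by (simp add: u_eq field_simps)
    also have "\<dots> = - sin (\<theta> + 3*\<alpha>) / (2 * cos \<alpha> * sin \<theta>)"
      unfolding prod_p by simp
    also have "\<dots> \<ge> 0" using neg c1 st by (intro divide_nonneg_pos) auto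
    finally show ?thesis .
  qed
  have uflip: "u \<beta> (pi - \<theta>) = u \<beta> (-\<theta>)" for \<beta> \<theta>
    by (simp add: u_def cot_def)
  have dm: "0 \<le> u \<alpha> (-\<theta>) - 2 * cos (2*\<alpha>) * u (2*\<alpha>) (-\<theta>)"
    if t: "2*\<alpha> \<le> \<theta>" "\<theta> < 3*\<alpha>" for \<theta>
  proof (cases "\<theta> = 2*\<alpha>")
    case True
    then show ?thesis using um[of "2*\<alpha>"] \<alpha> s[of "2*\<alpha>"] c2 by (simp add: u_minus_eq[of "2*\<alpha>" "2*\<alpha>"])
  next
    case False
    then show ?thesis using dp[of "pi - \<theta>"] t by (simp add: uflip)
  qed
  show "0 \<le> p1 \<alpha> \<theta>" "0 \<le> p2 \<alpha> \<theta>" "0 \<le> p3 \<alpha> \<theta>" "0 \<le> p4 \<alpha> \<theta>"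
    using \<alpha> up[of \<theta>] um[of \<theta>] vp[of \<theta>] vm[of \<theta>] dp[of \<theta>] dm[of \<theta>] c2
    by (auto simp: p1_def p2_def p3_def p4_def)
qed

lemma p_measurable [measurable]:
  "p1 \<alpha> \<in> borel_measurable borel" "p2 \<alpha> \<in> borel_measurable borel"
  "p3 \<alpha> \<in> borel_measurable borel" "p4 \<alpha> \<in> borel_measurable borel"
  unfolding p1_def[abs_def] p2_def[abs_def] p3_def[abs_def] p4_def[abs_def] u_def cot_def
  by measurable

lemma tau_measurable [measurable]:
  "tau1 \<alpha> \<in> borel_measurable borel" "tau2 \<alpha> \<in> borel_measurable borel"
  "tau3 \<alpha> \<in> borel_measurable borel" "tau4 \<alpha> \<in> borel_measurable borel"
  unfolding tau1_def[abs_def] tau2_def[abs_def] tau3_def[abs_def] tau4_def[abs_def]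
  by measurable

lemma ennreal_K_eq:
  assumes "0 < \<alpha>" "\<alpha> < pi/6" "\<theta> \<in> {0..pi}"
  shows "ennreal (K \<alpha> \<theta> A) =
     ennreal (p1 \<alpha> \<theta>) * indicator A (tau1 \<alpha> \<theta>) + ennreal (p2 \<alpha> \<theta>) * indicator A (tau2 \<alpha> \<theta>)
   + ennreal (p3 \<alpha> \<theta>) * indicator A (tau3 \<alpha> \<theta>) + ennreal (p4 \<alpha> \<theta>) * indicator A (tau4 \<alpha> \<theta>)"
  using p_nonneg[OF assms] by (auto simp: K_def indicator_def ennreal_plus)

lemma emeasure_kernel_step:
  assumes \<alpha>: "0 < \<alpha>" "\<alpha> < pi/6"
    and M: "sets M = sets (restrict_space borel {0..pi})"
    and A: "A \<in> sets (restrict_space borel {0..pi})"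
  shows "emeasure (kernel_step \<alpha> M) A = (\<integral>\<^sup>+ \<theta>. ennreal (K \<alpha> \<theta> A) \<partial>M)"
proof (rule emeasure_measure_of[OF kernel_step_def sets_restrict_Icc_Pow])
  have space_M: "space M = {0..pi}"
    using sets_eq_imp_space_eq[OF M] by (simp add: space_restrict_space)
  have borel: "B \<in> sets borel" if "B \<in> sets (restrict_space borel {0..pi})" for B :: "real set"
    using that by (simp add: sets_restrict_space_iff)
  have meas: "(\<lambda>\<theta>. ennreal (K \<alpha> \<theta> B)) \<in> borel_measurable M"
    if "B \<in> sets (restrict_space borel {0..pi})" for B
  proof -
    have [measurable]: "B \<in> sets borel" by (rule borel[OF that])
    have "(\<lambda>\<theta>. ennreal (K \<alpha> \<theta> B)) \<in> borel_measurable (restrict_space borel {0..pi})"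
      unfolding K_def by (rule measurable_restrict_space1) measurable
    then show ?thesis using measurable_cong_sets[OF M refl] by blast
  qed
  show "A \<in> sets (kernel_step \<alpha> M)" using A by (simp add: sets_kernel_step)
  show "positive (sets (kernel_step \<alpha> M)) (\<lambda>A. \<integral>\<^sup>+ \<theta>. ennreal (K \<alpha> \<theta> A) \<partial>M)"
    by (simp add: positive_def K_def)
  show "countably_additive (sets (kernel_step \<alpha> M)) (\<lambda>A. \<integral>\<^sup>+ \<theta>. ennreal (K \<alpha> \<theta> A) \<partial>M)"
  proof (rule countably_additiveI)
    fix B :: "nat \<Rightarrow> real set"
    assume B: "range B \<subseteq> sets (kernel_step \<alpha> M)" "disjoint_family B"
    have "(\<Sum>i. \<integral>\<^sup>+ \<theta>. ennreal (K \<alpha> \<theta> (B i)) \<partial>M) = (\<integral>\<^sup>+ \<theta>. (\<Sum>i. ennreal (K \<alpha> \<theta> (B i))) \<partial>M)"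
      using B(1) by (intro nn_integral_suminf[symmetric] meas) (auto simp: sets_kernel_step)
    also have "\<dots> = (\<integral>\<^sup>+ \<theta>. ennreal (K \<alpha> \<theta> (\<Union>i. B i)) \<partial>M)"
    proof (rule nn_integral_cong)
      fix \<theta> assume "\<theta> \<in> space M"
      then have "\<theta> \<in> {0..pi}" by (simp add: space_M)
      note eq = ennreal_K_eq[OF \<alpha> this]
      show "(\<Sum>i. ennreal (K \<alpha> \<theta> (B i))) = ennreal (K \<alpha> \<theta> (\<Union>i. B i))"
        unfolding eq
        by (simp add: suminf_add[symmetric] suminf_indicator[OF B(2)])
    qed
    finally show "(\<Sum>i. \<integral>\<^sup>+ \<theta>. ennreal (K \<alpha> \<theta> (B i)) \<partial>M)
        = (\<integral>\<^sup>+ \<theta>. ennreal (K \<alpha> \<theta> (\<Union> (range B))) \<partial>M)" .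
  qed
qed

end

(*
  With weights q_i = p_i sin one has detailed balance, so P f = sum_i p_i (f o tau_i) is a
  self-adjoint contraction of L^2(sin), and the norms of P^n f decrease; hence P^n f - P^(n+2) f
  tends to 0 in L^2(sin). For s = 1, -1 the Dirichlet energy of g_n = P^n f + s P^(n+1) f therefore
  tends to 0, i.e. g_n o tau_i - s g_n tends to 0 wherever p_i > 0. Extend g_n to the circle, evenly
  for s = 1 and oddly for s = -1: the maps tau_i then turn into the rotation by 2 alpha, and the
  extension is asymptotically invariant under the rotation by 4 alpha. As alpha / (2 pi) is
  irrational, g_n is asymptotically equal to its mean in the weak sense; the mean is identified by
  testing against the invariant density sin. Half the sum over s = 1, -1 gives the weak limit of
  P^n f, which is integrated against the density of nu.
*)

theory Submission
  imports Defs
begin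

section \<open>The weights of the kernel against the sine density\<close>

text \<open>From every angle the kernel charges at most four points, so it never smooths: started at
  a point, all iterates stay on a countable set. Hence P^n f cannot converge pointwise to its mean
  for every bounded Borel f, and the aim is only the convergence of the integral of \<phi> * P^n f
  for a fixed integrable \<phi>, which is what a density of \<nu> provides. Monotone norms control
  P^n f - P^(n+2) f but not P^n f - P^(n+1) f, because a priori the spectrum of P may reach -1. The
  two signs s separate the behaviour near the spectral values 1 and -1. For s = -1 the rotation by
  2\<alpha> asymptotically changes the sign of the extension, so it is squared to the rotation by
  4\<alpha> before the density of an irrational orbit is used. No L^2 space is built: all functions
  are bounded Borel functions on the line and the weights vanish off [0,pi], which turns each tau_i
  into an affine substitution over the whole line.\<close>

locale triangular_cell =
  fixes \<alpha> :: real
  assumes \<alpha>_pos: "0 < \<alpha>" and \<alpha>_less: "\<alpha> < pi/6"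
begin

lemma cos_\<alpha>_pos: "0 < cos \<alpha>" "0 < cos (2*\<alpha>)"
  using \<alpha>_pos \<alpha>_less by (auto intro!: cos_gt_zero_pi)

text \<open>The flow along each \<open>tau1\<close>, ..., \<open>tau4\<close> when the incoming
  angle has density sin. The cutoff removes the range where the p_i mean nothing and makes
  substitutions on the whole line possible.\<close>

definition q1 :: "real \<Rightarrow> real" where "q1 \<theta> = indicator {0..pi} \<theta> * (sin \<theta> * p1 \<alpha> \<theta>)"
definition q2 :: "real \<Rightarrow> real" where "q2 \<theta> = indicator {0..pi} \<theta> * (sin \<theta> * p2 \<alpha> \<theta>)"
definition q3 :: "real \<Rightarrow> real" where "q3 \<theta> = indicator {0..pi} \<theta> * (sin \<theta> * p3 \<alpha> \<theta>)"
definition q4 :: "real \<Rightarrow> real" where "q4 \<theta> = indicator {0..pi} \<theta> * (sin \<theta> * p4 \<alpha> \<theta>)"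

lemma q_measurable [measurable]:
  "q1 \<in> borel_measurable borel" "q2 \<in> borel_measurable borel"
  "q3 \<in> borel_measurable borel" "q4 \<in> borel_measurable borel"
  unfolding q1_def[abs_def] q2_def[abs_def] q3_def[abs_def] q4_def[abs_def] by measurable

text \<open>The factor sin cancels the pole of cot; the range of \<theta> keeps sin
  positive.\<close>

lemma sin_mult_u:
  assumes "\<alpha> \<le> \<theta>" "\<theta> < pi"
  shows "sin \<theta> * u \<alpha> \<theta> = sin (\<theta> + \<alpha>) / (2 * cos \<alpha>)"
    and "sin \<theta> * u \<alpha> (-\<theta>) = sin (\<theta> - \<alpha>) / (2 * cos \<alpha>)"
    and "sin \<theta> * (2 * cos (2*\<alpha>) * u (2*\<alpha>) \<theta>) = sin (\<theta> + 2*\<alpha>)"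
    and "sin \<theta> * (2 * cos (2*\<alpha>) * u (2*\<alpha>) (-\<theta>)) = sin (\<theta> - 2*\<alpha>)"
proof -
  have "0 < sin \<theta>" using assms \<alpha>_pos by (intro sin_gt_zero) auto
  then show "sin \<theta> * u \<alpha> \<theta> = sin (\<theta> + \<alpha>) / (2 * cos \<alpha>)"
    and "sin \<theta> * (2 * cos (2*\<alpha>) * u (2*\<alpha>) \<theta>) = sin (\<theta> + 2*\<alpha>)"
    and "sin \<theta> * u \<alpha> (-\<theta>) = sin (\<theta> - \<alpha>) / (2 * cos \<alpha>)"
    and "sin \<theta> * (2 * cos (2*\<alpha>) * u (2*\<alpha>) (-\<theta>)) = sin (\<theta> - 2*\<alpha>)"
    using cos_\<alpha>_pos u_eq[of \<alpha> \<theta>] u_eq[of "2*\<alpha>" \<theta>] u_minus_eq[of \<alpha> \<theta>] u_minus_eq[of "2*\<alpha>" \<theta>] by simp_all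
qed

text \<open>This is u_\<alpha>(\<theta>) + u_\<alpha>(-\<theta>) = 1 multiplied by sin. Taken at
  \<theta> + 2*\<alpha> and \<theta> - 2*\<alpha> it also collapses the differences in
  \<open>p2\<close> and \<open>p4\<close> to a single quotient.\<close>

lemma sin_combine:
  "sin (\<theta> + \<alpha>) / (2 * cos \<alpha>) + sin (\<theta> - \<alpha>) / (2 * cos \<alpha>) = sin \<theta>"
  using cos_\<alpha>_pos by (simp add: sin_add sin_diff field_simps)

lemma q1_eq:
  "q1 \<theta> = (if \<theta> < 0 then 0 else if \<theta> < \<alpha> then sin \<theta>
     else if \<theta> < pi - 3*\<alpha> then sin (\<theta> + \<alpha>) / (2 * cos \<alpha>)
     else if \<theta> < pi - 2*\<alpha> then sin (\<theta> + 2*\<alpha>) else 0)"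
  using \<alpha>_pos \<alpha>_less by (simp add: q1_def p1_def sin_mult_u indicator_def)

text \<open>The value sin pi = 0 at pi goes to the last branch; the pieces are then exactly those of
  \<open>q1\<close> moved by 2*\<alpha>, so that \<open>q3_shift\<close> has no exceptional
  point.\<close>

lemma q3_eq:
  "q3 \<theta> = (if \<theta> < 2*\<alpha> then 0 else if \<theta> < 3*\<alpha> then sin (\<theta> - 2*\<alpha>)
     else if \<theta> < pi - \<alpha> then sin (\<theta> - \<alpha>) / (2 * cos \<alpha>)
     else if \<theta> < pi then sin \<theta> else 0)"
  using \<alpha>_pos \<alpha>_less by (auto simp add: q3_def p3_def sin_mult_u indicator_def)

lemma q2_eq:
  "q2 \<theta> = (if \<theta> < pi - 3*\<alpha> then 0 else if \<theta> < pi - 2*\<alpha> then - sin (\<theta> + 3*\<alpha>) / (2 * cos \<alpha>)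
     else if \<theta> < pi - \<alpha> then sin (\<theta> + \<alpha>) / (2 * cos \<alpha>) else 0)"
proof -
  have "sin (\<theta> + \<alpha>) / (2 * cos \<alpha>) - sin (\<theta> + 2*\<alpha>) = - sin (\<theta> + 3*\<alpha>) / (2 * cos \<alpha>)"
    using sin_combine[of "\<theta> + 2*\<alpha>"] by (simp add: algebra_simps)
  then show ?thesis
    using \<alpha>_pos \<alpha>_less by (simp add: q2_def p2_def sin_mult_u right_diff_distrib indicator_def)
qed

lemma q4_eq:
  "q4 \<theta> = (if \<theta> < \<alpha> then 0 else if \<theta> < 2*\<alpha> then sin (\<theta> - \<alpha>) / (2 * cos \<alpha>)
     else if \<theta> < 3*\<alpha> then - sin (\<theta> - 3*\<alpha>) / (2 * cos \<alpha>) else 0)"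
proof -
  have "sin (\<theta> - \<alpha>) / (2 * cos \<alpha>) - sin (\<theta> - 2*\<alpha>) = - sin (\<theta> - 3*\<alpha>) / (2 * cos \<alpha>)"
    using sin_combine[of "\<theta> - 2*\<alpha>"] by (simp add: algebra_simps)
  then show ?thesis
    using \<alpha>_pos \<alpha>_less by (simp add: q4_def p4_def sin_mult_u right_diff_distrib indicator_def)
qed

lemma q3_shift: "q3 (\<theta> + 2*\<alpha>) = q1 \<theta>"
  using \<alpha>_pos \<alpha>_less by (auto simp add: q1_eq q3_eq algebra_simps)

text \<open>The reflection fixes pi - 2*\<alpha> and exchanges the two pieces of \<open>q2\<close>
  on either side of it, whose formulas correspond by the symmetry of sin about pi.\<close>

lemma q2_reflect: "q2 (2*pi - 4*\<alpha> - \<theta>) = q2 \<theta>"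
proof -
  have "sin (2*pi - 4*\<alpha> - \<theta> + 3*\<alpha>) = - sin (\<theta> + \<alpha>)"
    "sin (2*pi - 4*\<alpha> - \<theta> + \<alpha>) = - sin (\<theta> + 3*\<alpha>)"
    using sin_2pi_minus[of "\<theta> + \<alpha>"] sin_2pi_minus[of "\<theta> + 3*\<alpha>"]
    by (simp_all add: algebra_simps)
  moreover have "\<theta> = pi - 2*\<alpha> \<or> \<theta> < pi - 2*\<alpha> \<or> pi - 2*\<alpha> < \<theta>" by arith
  \<comment> \<open>The pieces are half-open and the reflection swaps open and closed ends; this is
    harmless because the formulas vanish at both outer ends.\<close>
  moreover have "sin (\<theta> + 3*\<alpha>) = 0" if "\<theta> = pi - 3*\<alpha>" using that by simp
  moreover have "sin (\<theta> + \<alpha>) = 0" if "\<theta> = pi - \<alpha>" using that by simp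
  ultimately show ?thesis
    using \<alpha>_pos by (cases "\<theta> = pi - 3*\<alpha>"; cases "\<theta> = pi - \<alpha>") (auto simp add: q2_eq)
qed

lemma q4_reflect: "q4 (4*\<alpha> - \<theta>) = q4 \<theta>"
proof -
  have "sin (4*\<alpha> - \<theta> - \<alpha>) = - sin (\<theta> - 3*\<alpha>)" "sin (4*\<alpha> - \<theta> - 3*\<alpha>) = - sin (\<theta> - \<alpha>)"
    using sin_minus[of "\<theta> - 3*\<alpha>"] sin_minus[of "\<theta> - \<alpha>"] by (simp_all add: algebra_simps)
  moreover have "\<theta> = 2*\<alpha> \<or> \<theta> < 2*\<alpha> \<or> 2*\<alpha> < \<theta>" by arith
  ultimately show ?thesis
    using \<alpha>_pos by (cases "\<theta> = 3*\<alpha>"; cases "\<theta> = \<alpha>") (auto simp add: q4_eq)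
qed

lemma q_sum: "q1 \<theta> + q2 \<theta> + q3 \<theta> + q4 \<theta> = indicator {0..pi} \<theta> * sin \<theta>"
  using \<alpha>_pos \<alpha>_less sin_combine[of \<theta>] sin_combine[of "\<theta> + 2*\<alpha>"] sin_combine[of "\<theta> - 2*\<alpha>"]
  by (auto simp add: q1_eq q2_eq q3_eq q4_eq indicator_def algebra_simps)

lemma q_nonneg: "0 \<le> q1 \<theta>" "0 \<le> q2 \<theta>" "0 \<le> q3 \<theta>" "0 \<le> q4 \<theta>"
  using p_nonneg[OF \<alpha>_pos \<alpha>_less, of \<theta>]
  by (auto simp: q1_def q2_def q3_def q4_def indicator_def sin_ge_zero)

lemma q_le: "q1 \<theta> \<le> indicator {0..pi} \<theta>" "q2 \<theta> \<le> indicator {0..pi} \<theta>"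
  "q3 \<theta> \<le> indicator {0..pi} \<theta>" "q4 \<theta> \<le> indicator {0..pi} \<theta>"
proof -
  have "indicator {0..pi} \<theta> * sin \<theta> \<le> (indicator {0..pi} \<theta> :: real)"
    by (simp add: indicator_def)
  then show "q1 \<theta> \<le> indicator {0..pi} \<theta>" "q2 \<theta> \<le> indicator {0..pi} \<theta>"
    "q3 \<theta> \<le> indicator {0..pi} \<theta>" "q4 \<theta> \<le> indicator {0..pi} \<theta>"
    using q_sum[of \<theta>] q_nonneg[of \<theta>] by linarith+
qed

text \<open>For an involution tau, passing from x to tau x multiplies g (tau x) - s * g x by -s when
  s^2 = 1. Hence one half of the intervals symmetric under \<open>tau2\<close> and
  \<open>tau4\<close> is enough, and likewise \<open>tau1\<close> serves for its inverse
  \<open>tau3\<close>.\<close>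

lemma q_pos:
  "0 < \<theta> \<Longrightarrow> \<theta> < pi - 2*\<alpha> \<Longrightarrow> 0 < q1 \<theta>"
  "pi - 2*\<alpha> < \<theta> \<Longrightarrow> \<theta> < pi - \<alpha> \<Longrightarrow> 0 < q2 \<theta>"
  "\<alpha> < \<theta> \<Longrightarrow> \<theta> < 2*\<alpha> \<Longrightarrow> 0 < q4 \<theta>"
  using \<alpha>_pos \<alpha>_less cos_\<alpha>_pos
  by (auto simp add: q1_eq q2_eq q4_eq intro!: divide_pos_pos sin_gt_zero)

text \<open>Division of \<open>q_sum\<close> by sin; at the two zeros of sin the values are read off
  the definitions.\<close>

lemma p_sum:
  assumes "\<theta> \<in> {0..pi}"
  shows "p1 \<alpha> \<theta> + p2 \<alpha> \<theta> + p3 \<alpha> \<theta> + p4 \<alpha> \<theta> = 1"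
proof (cases "\<theta> = 0 \<or> \<theta> = pi")
  case True
  then show ?thesis using \<alpha>_pos \<alpha>_less by (auto simp: p1_def p2_def p3_def p4_def)
next
  case False
  then have s: "0 < sin \<theta>" using assms by (intro sin_gt_zero) auto
  have "sin \<theta> * (p1 \<alpha> \<theta> + p2 \<alpha> \<theta> + p3 \<alpha> \<theta> + p4 \<alpha> \<theta>) = sin \<theta> * 1"
    using q_sum[of \<theta>] assms by (simp add: q1_def q2_def q3_def q4_def algebra_simps)
  then show ?thesis using s by (simp only: mult_cancel_left) auto
qed

end

section \<open>Reversibility\<close>

text \<open>Stand-in for L^2(sin): the class contains indicators, is closed under products, shifts,
  reflections and the transition operator, and is integrable against any bounded Borel weight that
  vanishes off a compact interval.\<close>

definition bounded_measurable :: "(real \<Rightarrow> real) \<Rightarrow> bool" where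
  "bounded_measurable f \<longleftrightarrow> f \<in> borel_measurable borel \<and> (\<exists>C. \<forall>x. \<bar>f x\<bar> \<le> C)"

lemma bounded_measurableI:
  "f \<in> borel_measurable borel \<Longrightarrow> (\<And>x. \<bar>f x\<bar> \<le> C) \<Longrightarrow> bounded_measurable f"
  by (auto simp: bounded_measurable_def)

lemma bounded_measurableD [measurable_dest]:
  "bounded_measurable f \<Longrightarrow> f \<in> borel_measurable borel"
  by (simp add: bounded_measurable_def)

lemma bounded_measurable_const: "bounded_measurable (\<lambda>x. c)"
  by (auto simp: bounded_measurable_def)

lemma bounded_measurable_add:
  assumes "bounded_measurable f" "bounded_measurable g"
  shows "bounded_measurable (\<lambda>x. f x + g x)"
proof -
  obtain C D where *: "\<And>x. \<bar>f x\<bar> \<le> C" "\<And>x. \<bar>g x\<bar> \<le> D"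
    using assms by (auto simp: bounded_measurable_def)
  have "\<bar>f x + g x\<bar> \<le> C + D" for x using *[of x] by linarith
  then show ?thesis using assms by (intro bounded_measurableI[of _ "C + D"]) auto
qed

lemma bounded_measurable_mult:
  assumes "bounded_measurable f" "bounded_measurable g"
  shows "bounded_measurable (\<lambda>x. f x * g x)"
proof -
  obtain C D where *: "\<And>x. \<bar>f x\<bar> \<le> C" "\<And>x. \<bar>g x\<bar> \<le> D"
    using assms by (auto simp: bounded_measurable_def)
  have "\<bar>f x * g x\<bar> \<le> C * D" for x
    unfolding abs_mult using *[of x] by (intro mult_mono) auto
  then show ?thesis using assms by (intro bounded_measurableI[of _ "C * D"]) auto
qed

lemma bounded_measurable_diff:
  assumes "bounded_measurable f" "bounded_measurable g"
  shows "bounded_measurable (\<lambda>x. f x - g x)"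
proof -
  have "bounded_measurable (\<lambda>x. f x + (-1) * g x)"
    by (rule bounded_measurable_add[OF assms(1) bounded_measurable_mult[OF bounded_measurable_const assms(2)]])
  then show ?thesis by simp
qed

lemma bounded_measurable_compose:
  assumes "bounded_measurable f" "h \<in> borel_measurable borel"
  shows "bounded_measurable (\<lambda>x. f (h x))"
  using assms measurable_compose[OF assms(2), of f borel] by (auto simp: bounded_measurable_def)

lemma bounded_measurable_power2:
  "bounded_measurable f \<Longrightarrow> bounded_measurable (\<lambda>x. (f x)\<^sup>2)"
  unfolding power2_eq_square by (rule bounded_measurable_mult)

lemma bounded_measurable_shift:
  "bounded_measurable f \<Longrightarrow> bounded_measurable (\<lambda>x. f (x + c))"
  "bounded_measurable f \<Longrightarrow> bounded_measurable (\<lambda>x. f (x - c))"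
  "bounded_measurable f \<Longrightarrow> bounded_measurable (\<lambda>x. f (c - x))"
  using bounded_measurable_compose[of f "\<lambda>x. x + c"] bounded_measurable_compose[of f "\<lambda>x. x - c"]
    bounded_measurable_compose[of f "\<lambda>x. c - x"] by simp_all

lemma integrable_bounded_measurable:
  assumes "bounded_measurable f" "\<And>x. \<bar>r x\<bar> \<le> indicator {a..b::real} x"
    "r \<in> borel_measurable borel"
  shows "integrable lborel (\<lambda>x. r x * f x)"
proof -
  obtain C where C: "\<And>x. \<bar>f x\<bar> \<le> C" using assms by (auto simp: bounded_measurable_def)
  show ?thesis
  proof (rule Bochner_Integration.integrable_bound)
    show "integrable lborel (\<lambda>x. indicator {a..b} x * C)"
      by (intro integrable_mult_left integrable_real_indicator) (auto simp: emeasure_lborel_Icc_eq)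
    have "\<bar>r x * f x\<bar> \<le> \<bar>indicator {a..b} x * C\<bar>" for x
      unfolding abs_mult using assms(2)[of x] C[of x] by (intro mult_mono) auto
    then show "AE x in lborel. norm (r x * f x) \<le> norm (indicator {a..b} x * C)" by simp
  qed (use assms in measurable)
qed

lemma power2_tendsto_0_imp_abs:
  assumes "\<And>n. x n \<ge> 0" "\<And>n. (x n)\<^sup>2 \<le> c * y n" "y \<longlonglongrightarrow> (0::real)"
  shows "x \<longlonglongrightarrow> (0::real)"
proof -
  have "(\<lambda>n. (x n)\<^sup>2) \<longlonglongrightarrow> 0"
    by (rule tendsto_sandwich[OF _ _ tendsto_const, where h="\<lambda>n. c * y n"])
       (use assms tendsto_mult_right_zero[OF assms(3), of c] in auto)
  then have "(\<lambda>n. sqrt ((x n)\<^sup>2)) \<longlonglongrightarrow> sqrt 0" by (rule tendsto_real_sqrt)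
  then show ?thesis using assms(1) by simp
qed

section \<open>The transition operator and its quadratic form\<close>

context triangular_cell
begin

lemma q_integrable:
  assumes "bounded_measurable f"
  shows "integrable lborel (\<lambda>x. q1 x * f x)" "integrable lborel (\<lambda>x. q2 x * f x)"
    "integrable lborel (\<lambda>x. q3 x * f x)" "integrable lborel (\<lambda>x. q4 x * f x)"
  using q_nonneg q_le by (auto intro!: integrable_bounded_measurable[of _ _ 0 pi] assms)

text \<open>The invariant density without normalisation: its mass is 2, so means are
  \<open>inner_w f (\<lambda>_. 1) / 2\<close>.\<close>

definition w :: "real \<Rightarrow> real" where "w x = indicator {0..pi} x * sin x"

lemma w_measurable [measurable]: "w \<in> borel_measurable borel"
  unfolding w_def[abs_def] by measurable

lemma w_nonneg: "0 \<le> w x" and w_le: "w x \<le> indicator {0..pi} x"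
  by (auto simp: w_def indicator_def sin_ge_zero)

lemma w_integrable: "bounded_measurable f \<Longrightarrow> integrable lborel (\<lambda>x. w x * f x)"
  using w_nonneg w_le by (auto intro!: integrable_bounded_measurable[of _ _ 0 pi])

text \<open>Dual form of the kernel: the expectation of f at the outgoing angle. The maps tau_i are
  spelled out so that substitutions by translation and reflection apply directly.\<close>

definition P :: "(real \<Rightarrow> real) \<Rightarrow> real \<Rightarrow> real" where
  "P f x = indicator {0..pi} x * (p1 \<alpha> x * f (x + 2*\<alpha>) + p2 \<alpha> x * f (2*pi - 4*\<alpha> - x)
     + p3 \<alpha> x * f (x - 2*\<alpha>) + p4 \<alpha> x * f (4*\<alpha> - x))"

lemma P_bound:
  assumes "\<And>x. \<bar>f x\<bar> \<le> C"
  shows "\<bar>P f x\<bar> \<le> C"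
proof (cases "x \<in> {0..pi}")
  case True
  have *: "\<bar>p * f y\<bar> \<le> p * C" if "0 \<le> p" for p y
    using that assms[of y] by (simp add: abs_mult mult_left_mono)
  note n = p_nonneg[OF \<alpha>_pos \<alpha>_less True]
  have "\<bar>P f x\<bar> \<le> \<bar>p1 \<alpha> x * f (x + 2*\<alpha>)\<bar> + \<bar>p2 \<alpha> x * f (2*pi - 4*\<alpha> - x)\<bar>
     + \<bar>p3 \<alpha> x * f (x - 2*\<alpha>)\<bar> + \<bar>p4 \<alpha> x * f (4*\<alpha> - x)\<bar>"
    using True by (simp add: P_def)
  also have "\<dots> \<le> p1 \<alpha> x * C + p2 \<alpha> x * C + p3 \<alpha> x * C + p4 \<alpha> x * C"
    using n by (intro add_mono *)
  also have "\<dots> = (p1 \<alpha> x + p2 \<alpha> x + p3 \<alpha> x + p4 \<alpha> x) * C" by (simp add: algebra_simps)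
  finally show ?thesis using p_sum[OF True] by simp
next
  case False
  then show ?thesis using assms[of x] by (auto simp: P_def)
qed

lemma P_measurable [measurable]:
  assumes [measurable]: "f \<in> borel_measurable borel"
  shows "P f \<in> borel_measurable borel"
  unfolding P_def[abs_def] by measurable

lemma bounded_measurable_P: "bounded_measurable f \<Longrightarrow> bounded_measurable (P f)"
  using P_bound[of f] by (auto simp: bounded_measurable_def)

lemma w_mult_P:
  "w x * P f x = q1 x * f (x + 2*\<alpha>) + q2 x * f (2*pi - 4*\<alpha> - x)
     + q3 x * f (x - 2*\<alpha>) + q4 x * f (4*\<alpha> - x)"
  by (auto simp: w_def P_def q1_def q2_def q3_def q4_def indicator_def algebra_simps)

lemma integral_add4:
  fixes f1 f2 f3 f4 :: "real \<Rightarrow> real"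
  assumes "integrable M f1" "integrable M f2" "integrable M f3" "integrable M f4"
  shows "(\<integral>x. f1 x + f2 x + f3 x + f4 x \<partial>M) = integral\<^sup>L M f1 + integral\<^sup>L M f2 + integral\<^sup>L M f3 + integral\<^sup>L M f4"
  using assms by simp

definition inner_w :: "(real \<Rightarrow> real) \<Rightarrow> (real \<Rightarrow> real) \<Rightarrow> real" where
  "inner_w f g = (\<integral>x. w x * (f x * g x) \<partial>lborel)"

lemma inner_w_commute: "inner_w f g = inner_w g f"
  by (simp add: inner_w_def mult.commute)

lemma inner_w_P:
  assumes f: "bounded_measurable f" and g: "bounded_measurable g"
  shows "inner_w (P f) g = (\<integral>x. q1 x * (f (x + 2*\<alpha>) * g x) \<partial>lborel)
    + (\<integral>x. q2 x * (f (2*pi - 4*\<alpha> - x) * g x) \<partial>lborel)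
    + (\<integral>x. q3 x * (f (x - 2*\<alpha>) * g x) \<partial>lborel)
    + (\<integral>x. q4 x * (f (4*\<alpha> - x) * g x) \<partial>lborel)"
proof -
  have "inner_w (P f) g = (\<integral>x. q1 x * (f (x + 2*\<alpha>) * g x) + q2 x * (f (2*pi - 4*\<alpha> - x) * g x)
    + q3 x * (f (x - 2*\<alpha>) * g x) + q4 x * (f (4*\<alpha> - x) * g x) \<partial>lborel)"
    unfolding inner_w_def mult.assoc[symmetric] w_mult_P by (simp add: algebra_simps)
  also have "\<dots> = (\<integral>x. q1 x * (f (x + 2*\<alpha>) * g x) \<partial>lborel)
    + (\<integral>x. q2 x * (f (2*pi - 4*\<alpha> - x) * g x) \<partial>lborel)
    + (\<integral>x. q3 x * (f (x - 2*\<alpha>) * g x) \<partial>lborel)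
    + (\<integral>x. q4 x * (f (4*\<alpha> - x) * g x) \<partial>lborel)"
    by (intro integral_add4 q_integrable bounded_measurable_mult
        bounded_measurable_shift[OF f] g)
  finally show ?thesis .
qed

text \<open>Detailed balance: \<open>\<tau>\<^sub>1\<close> and \<open>\<tau>\<^sub>3\<close> are inverse to each other and \<open>\<tau>\<^sub>2\<close>, \<open>\<tau>\<^sub>4\<close> are
  involutions, and these maps preserve the weights \<open>q\<^sub>i = p\<^sub>i sin\<close> accordingly.\<close>

lemma P_symmetric:
  assumes f: "bounded_measurable f" and g: "bounded_measurable g"
  shows "inner_w (P f) g = inner_w f (P g)"
proof -
  have 1: "(\<integral>x. q3 x * (h x * k (x - 2*\<alpha>)) \<partial>lborel) = (\<integral>x. q1 x * (h (x + 2*\<alpha>) * k x) \<partial>lborel)"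
    for h k :: "real \<Rightarrow> real"
    by (subst lborel_integral_real_affine[of 1 _ "2*\<alpha>"])
       (simp_all add: add.commute[of "2*\<alpha>"] q3_shift)
  have 2: "(\<integral>x. q2 x * (f (2*pi - 4*\<alpha> - x) * g x) \<partial>lborel)
      = (\<integral>x. q2 x * (f x * g (2*pi - 4*\<alpha> - x)) \<partial>lborel)"
    by (subst lborel_integral_real_affine[of "-1" _ "2*pi - 4*\<alpha>"]) (simp_all add: q2_reflect)
  have 4: "(\<integral>x. q4 x * (f (4*\<alpha> - x) * g x) \<partial>lborel)
      = (\<integral>x. q4 x * (f x * g (4*\<alpha> - x)) \<partial>lborel)"
    by (subst lborel_integral_real_affine[of "-1" _ "4*\<alpha>"]) (simp_all add: q4_reflect)
  show ?thesis
    unfolding inner_w_commute[of f "P g"] inner_w_P[OF f g] inner_w_P[OF g f]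
    using 1[of g f] 1[of f g] 2 4 by (simp add: mult.commute)
qed

lemma P_one: "P (\<lambda>_. 1) x = indicator {0..pi} x"
  using p_sum[of x] by (auto simp: P_def indicator_def)

text \<open>Stationarity of the sine density: by symmetry P moves over to the constant 1, which it
  fixes on the support of \<open>w\<close>.\<close>

lemma inner_w_P_one:
  assumes "bounded_measurable f"
  shows "inner_w (P f) (\<lambda>_. 1) = inner_w f (\<lambda>_. 1)"
  unfolding P_symmetric[OF assms bounded_measurable_const]
  unfolding inner_w_def P_one by (rule Bochner_Integration.integral_cong) (auto simp: w_def indicator_def)

text \<open>Expanding the squares, the terms in f^2 add up to \<open>w\<close> times P (f^2), whose
  integral is that of \<open>w\<close> f^2 by stationarity; the terms in g^2 add up because the q_i
  sum to \<open>w\<close>. Two functions are kept because both g = P f (contraction) and g = s * f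
  (energy) are needed.\<close>

lemma dirichlet_form:
  assumes f: "bounded_measurable f" and g: "bounded_measurable g"
  shows "(\<integral>x. q1 x * (f (x + 2*\<alpha>) - g x)\<^sup>2 \<partial>lborel)
    + (\<integral>x. q2 x * (f (2*pi - 4*\<alpha> - x) - g x)\<^sup>2 \<partial>lborel)
    + (\<integral>x. q3 x * (f (x - 2*\<alpha>) - g x)\<^sup>2 \<partial>lborel)
    + (\<integral>x. q4 x * (f (4*\<alpha> - x) - g x)\<^sup>2 \<partial>lborel)
    = inner_w f f + inner_w g g - 2 * inner_w (P f) g"
proof -
  have "(\<integral>x. q1 x * (f (x + 2*\<alpha>) - g x)\<^sup>2 \<partial>lborel)
    + (\<integral>x. q2 x * (f (2*pi - 4*\<alpha> - x) - g x)\<^sup>2 \<partial>lborel)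
    + (\<integral>x. q3 x * (f (x - 2*\<alpha>) - g x)\<^sup>2 \<partial>lborel)
    + (\<integral>x. q4 x * (f (4*\<alpha> - x) - g x)\<^sup>2 \<partial>lborel)
    = (\<integral>x. q1 x * (f (x + 2*\<alpha>) - g x)\<^sup>2 + q2 x * (f (2*pi - 4*\<alpha> - x) - g x)\<^sup>2
      + q3 x * (f (x - 2*\<alpha>) - g x)\<^sup>2 + q4 x * (f (4*\<alpha> - x) - g x)\<^sup>2 \<partial>lborel)"
    by (intro integral_add4[symmetric] q_integrable bounded_measurable_power2 bounded_measurable_diff
        bounded_measurable_shift[OF f] g)
  also have "\<dots> = (\<integral>x. w x * (P (\<lambda>x. (f x)\<^sup>2) x) + w x * (g x)\<^sup>2 - 2 * (w x * (P f x * g x)) \<partial>lborel)"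
  proof (rule Bochner_Integration.integral_cong[OF refl])
    fix x
    have "w x = q1 x + q2 x + q3 x + q4 x" using q_sum[of x] by (simp add: w_def)
    then show "q1 x * (f (x + 2*\<alpha>) - g x)\<^sup>2 + q2 x * (f (2*pi - 4*\<alpha> - x) - g x)\<^sup>2
      + q3 x * (f (x - 2*\<alpha>) - g x)\<^sup>2 + q4 x * (f (4*\<alpha> - x) - g x)\<^sup>2
      = w x * (P (\<lambda>x. (f x)\<^sup>2) x) + w x * (g x)\<^sup>2 - 2 * (w x * (P f x * g x))"
      unfolding mult.assoc[symmetric, of "w x" "P f x"] w_mult_P
      by (simp add: algebra_simps power2_eq_square)
  qed
  also have "\<dots> = (\<integral>x. w x * (P (\<lambda>x. (f x)\<^sup>2) x) \<partial>lborel) + (\<integral>x. w x * (g x)\<^sup>2 \<partial>lborel)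
      - 2 * (\<integral>x. w x * (P f x * g x) \<partial>lborel)"
  proof -
    have "integrable lborel (\<lambda>x. w x * P (\<lambda>x. (f x)\<^sup>2) x)" "integrable lborel (\<lambda>x. w x * (g x)\<^sup>2)"
      "integrable lborel (\<lambda>x. w x * (P f x * g x))"
      by (intro w_integrable bounded_measurable_P bounded_measurable_power2 bounded_measurable_mult f g)+
    then show ?thesis by simp
  qed
  also have "(\<integral>x. w x * (P (\<lambda>x. (f x)\<^sup>2) x) \<partial>lborel) = inner_w f f"
    using inner_w_P_one[OF bounded_measurable_power2[OF f]] by (simp add: inner_w_def power2_eq_square)
  finally show ?thesis by (simp add: inner_w_def power2_eq_square)
qed

end

section \<open>Decay of the Dirichlet energy\<close>

text \<open>The integral over the nonnegative extended reals avoids integrability conditions;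
  localisation is left to indicator factors inside h.\<close>

definition L1_null :: "(nat \<Rightarrow> real \<Rightarrow> real) \<Rightarrow> bool" where
  "L1_null h \<longleftrightarrow> (\<forall>n. h n \<in> borel_measurable borel) \<and>
     (\<lambda>n. \<integral>\<^sup>+x. ennreal \<bar>h n x\<bar> \<partial>lborel) \<longlonglongrightarrow> 0"

lemma L1_null_dominated:
  assumes "L1_null h" "\<And>n. e n \<in> borel_measurable borel"
    "\<And>n. AE x in lborel. \<bar>e n x\<bar> \<le> \<bar>h n x\<bar>"
  shows "L1_null e"
  unfolding L1_null_def
proof (intro conjI allI)
  show "(\<lambda>n. \<integral>\<^sup>+x. ennreal \<bar>e n x\<bar> \<partial>lborel) \<longlonglongrightarrow> 0"
  proof (rule tendsto_sandwich[OF _ _ tendsto_const])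
    show "(\<lambda>n. \<integral>\<^sup>+x. ennreal \<bar>h n x\<bar> \<partial>lborel) \<longlonglongrightarrow> 0"
      using assms(1) by (simp add: L1_null_def)
    have "(\<integral>\<^sup>+x. ennreal \<bar>e n x\<bar> \<partial>lborel) \<le> (\<integral>\<^sup>+x. ennreal \<bar>h n x\<bar> \<partial>lborel)" for n
      using assms(3)[of n] by (intro nn_integral_mono_AE) (auto elim!: eventually_mono intro: ennreal_leI)
    then show "\<forall>\<^sub>F n in sequentially.
      (\<integral>\<^sup>+x. ennreal \<bar>e n x\<bar> \<partial>lborel) \<le> (\<integral>\<^sup>+x. ennreal \<bar>h n x\<bar> \<partial>lborel)" by simp
  qed simp
qed (use assms in auto)

text \<open>Absolute values are added because this is the shape of the majorants handed to
  \<open>L1_null_dominated\<close>.\<close>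

lemma L1_null_abs_add:
  assumes "L1_null h" "L1_null k"
  shows "L1_null (\<lambda>n x. \<bar>h n x\<bar> + \<bar>k n x\<bar>)"
proof -
  have [measurable]: "h n \<in> borel_measurable borel" "k n \<in> borel_measurable borel" for n
    using assms by (auto simp: L1_null_def)
  have "(\<lambda>n. (\<integral>\<^sup>+x. ennreal \<bar>h n x\<bar> \<partial>lborel) + (\<integral>\<^sup>+x. ennreal \<bar>k n x\<bar> \<partial>lborel)) \<longlonglongrightarrow> 0 + 0"
    using assms by (intro tendsto_add) (auto simp: L1_null_def)
  then show ?thesis
    by (simp add: L1_null_def nn_integral_add[symmetric] ennreal_plus[symmetric] del: ennreal_plus)
qed

lemma L1_null_affine:
  assumes "L1_null h" "c = 1 \<or> c = -1"
  shows "L1_null (\<lambda>n x. h n (t + c * x))"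
proof -
  have m [measurable]: "h n \<in> borel_measurable borel" for n
    using assms by (auto simp: L1_null_def)
  have "(\<integral>\<^sup>+x. ennreal \<bar>h n x\<bar> \<partial>lborel) = (\<integral>\<^sup>+x. ennreal \<bar>h n (t + c * x)\<bar> \<partial>lborel)" for n
    using assms(2) by (subst nn_integral_real_affine[of _ c t]) auto
  then show ?thesis using assms(1) by (simp add: L1_null_def)
qed

lemma L1_null_imp_integral:
  assumes "L1_null h"
  shows "(\<lambda>n. \<integral>x. h n x \<partial>lborel) \<longlonglongrightarrow> 0"
proof -
  \<comment> \<open>If \<open>h n\<close> is not integrable, its integral is 0 by convention and the
    bound still holds.\<close>
  have *: "ennreal (norm (\<integral>x. h n x \<partial>lborel)) \<le> (\<integral>\<^sup>+x. ennreal \<bar>h n x\<bar> \<partial>lborel)" for n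
    using integral_norm_bound_ennreal[of lborel "h n"]
    by (cases "integrable lborel (h n)") (auto simp: not_integrable_integral_eq)
  have "(\<lambda>n. ennreal (norm (\<integral>x. h n x \<partial>lborel))) \<longlonglongrightarrow> ennreal 0"
    by (rule tendsto_sandwich[OF _ _ tendsto_const])
       (use * assms in \<open>auto simp: L1_null_def\<close>)
  then show ?thesis
    by (subst (asm) tendsto_ennreal_iff) (auto intro: tendsto_norm_zero_cancel)
qed

lemma L1_nullI:
  assumes "\<And>n. integrable lborel (h n)" "\<And>n x. 0 \<le> h n x"
    "(\<lambda>n. \<integral>x. h n x \<partial>lborel) \<longlonglongrightarrow> 0"
  shows "L1_null h"
proof -
  have "(\<lambda>n. ennreal (\<integral>x. h n x \<partial>lborel)) \<longlonglongrightarrow> ennreal 0" by (rule tendsto_ennrealI[OF assms(3)])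
  moreover have "(\<integral>\<^sup>+x. ennreal \<bar>h n x\<bar> \<partial>lborel) = ennreal (\<integral>x. h n x \<partial>lborel)" for n
    using assms by (simp add: nn_integral_eq_integral)
  ultimately show ?thesis using assms(1) by (simp add: L1_null_def borel_measurable_integrable)
qed

text \<open>The weight is positive on S but need not be bounded away from 0. Where r is at least
  1/B, |h| is at most 1/B + B^2 * r * h^2; the rest of S shrinks to the empty set as B grows, and
  there |h| is at most C. So B is fixed first and n is sent to infinity afterwards.\<close>

lemma L1_null_remove_weight:
  fixes r :: "real \<Rightarrow> real"
  assumes [measurable]: "r \<in> borel_measurable borel" "\<And>n. h n \<in> borel_measurable borel"
    and S [measurable]: "S \<in> sets borel" "S \<subseteq> {a..b}" and pos: "\<And>x. x \<in> S \<Longrightarrow> 0 < r x"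
    and nonneg: "\<And>x. 0 \<le> r x"
    and bound: "\<And>n x. \<bar>h n x\<bar> \<le> C"
    and int: "\<And>n. integrable lborel (\<lambda>x. r x * (h n x)\<^sup>2)"
    and lim: "(\<lambda>n. \<integral>x. r x * (h n x)\<^sup>2 \<partial>lborel) \<longlonglongrightarrow> 0"
  shows "L1_null (\<lambda>n x. indicator S x * h n x)"
proof -
  have intS: "integrable lborel (\<lambda>x. indicator S x * f x)" if "bounded_measurable f" for f
    using S(2) by (intro integrable_bounded_measurable[OF that, of _ a b])
      (auto simp: indicator_def)
  have intSh: "integrable lborel (\<lambda>x. indicator S x * \<bar>h n x\<bar>)" for n
    using bound by (intro intS bounded_measurableI[of _ C]) auto
  \<comment> \<open>The part of the bound that does not depend on n, with B = k + 1.\<close>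
  define small where "small k x = (if real (Suc k) * r x < 1 then C else 0) + 1 / real (Suc k)" for k x
  have C: "0 \<le> C" using bound[of 0 0] by linarith
  have small_bm: "bounded_measurable (small k)" for k
    using C by (intro bounded_measurableI[of _ "C + 1"]) (auto simp: small_def[abs_def] field_simps)
  have split: "indicator S x * \<bar>h n x\<bar> \<le> indicator S x * small k x + (real (Suc k))\<^sup>2 * (r x * (h n x)\<^sup>2)"
    for n k x
  proof (cases "x \<in> S")
    case True
    define H where "H = \<bar>h n x\<bar>"
    have H: "0 \<le> H" "H \<le> C" "(h n x)\<^sup>2 = H\<^sup>2" using bound by (auto simp: H_def)
    define B where "B = real (Suc k)"
    have B: "1 \<le> B" by (simp add: B_def)
    \<comment> \<open>Either H is at most 1/B, or B * H is at least 1 and then H is at most B *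
      H^2.\<close>
    have "H \<le> 1 / B + B * H\<^sup>2"
    proof (cases "H \<le> 1 / B")
      case True
      then show ?thesis using B H by (simp add: add_increasing2)
    next
      case False
      then have "1 \<le> B * H" using B by (simp add: field_simps)
      then have "1 * H \<le> (B * H) * H" using H by (intro mult_right_mono) auto
      then show ?thesis using B by (simp add: power2_eq_square algebra_simps add_increasing)
    qed
    moreover have "B * H\<^sup>2 \<le> B\<^sup>2 * (r x * H\<^sup>2)" if "1 \<le> B * r x"
    proof -
      have "1 * (B * H\<^sup>2) \<le> (B * r x) * (B * H\<^sup>2)" using that B by (intro mult_right_mono) auto
      then show ?thesis by (simp add: power2_eq_square algebra_simps)
    qed
    moreover have "0 \<le> B\<^sup>2 * (r x * H\<^sup>2)" "0 \<le> 1 / B" using nonneg[of x] B by auto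
    ultimately show ?thesis
      using True H(2) unfolding H_def[symmetric] H(3) small_def B_def[symmetric] by (auto simp del: zero_le_divide_1_iff)
  next
    case False
    then show ?thesis using nonneg[of x] by simp
  qed
  have lim_small: "(\<lambda>k. \<integral>x. indicator S x * small k x \<partial>lborel) \<longlonglongrightarrow> (\<integral>x. 0 \<partial>(lborel::real measure))"
  proof (rule integral_dominated_convergence[where w="\<lambda>x. indicator S x * (C + 1)"])
    have "(\<lambda>k. indicator S x * small k x) \<longlonglongrightarrow> 0" for x
    proof (cases "x \<in> S")
      case True
      then have rx: "0 < r x" using pos by auto
      obtain N where N: "1 < real N * r x" using reals_Archimedean3[OF rx] by blast
      have "\<forall>\<^sub>F k in sequentially. 1 / real (Suc k) = indicator S x * small k x"
        using eventually_ge_at_top[of N]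
      proof eventually_elim
        case (elim k)
        have "real N * r x \<le> real (Suc k) * r x" using elim rx by (intro mult_right_mono) auto
        then show ?case using N True by (simp add: small_def)
      qed
      moreover have "(\<lambda>k. 1 / real (Suc k)) \<longlonglongrightarrow> 0" by (rule LIMSEQ_Suc[OF lim_1_over_n])
      ultimately show ?thesis by (rule Lim_transform_eventually[rotated])
    qed simp
    then show "AE x in lborel. (\<lambda>k. indicator S x * small k x) \<longlonglongrightarrow> 0" by simp
    show "integrable lborel (\<lambda>x. indicator S x * (C + 1))" by (intro intS bounded_measurable_const)
    show "AE x in lborel. norm (indicator S x * small k x) \<le> indicator S x * (C + 1)" for k
      using C by (auto simp: small_def indicator_def field_simps)
    show "(\<lambda>x. indicator S x * small k x) \<in> borel_measurable lborel" for k
      using bounded_measurableD[OF small_bm[of k]] by measurable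
  qed simp
  have "(\<lambda>n. \<integral>x. indicator S x * \<bar>h n x\<bar> \<partial>lborel) \<longlonglongrightarrow> 0"
  proof (rule LIMSEQ_I)
    fix e :: real assume e: "0 < e"
    have "\<forall>\<^sub>F k in sequentially. (\<integral>x. indicator S x * small k x \<partial>lborel) < e / 2"
      using lim_small e by (intro order_tendstoD(2)[of _ 0]) auto
    then obtain k where k: "(\<integral>x. indicator S x * small k x \<partial>lborel) < e / 2"
      by (auto simp: eventually_sequentially)
    have "(\<lambda>n. (real (Suc k))\<^sup>2 * (\<integral>x. r x * (h n x)\<^sup>2 \<partial>lborel)) \<longlonglongrightarrow> 0"
      by (rule tendsto_mult_right_zero[OF lim])
    then have "\<forall>\<^sub>F n in sequentially. (real (Suc k))\<^sup>2 * (\<integral>x. r x * (h n x)\<^sup>2 \<partial>lborel) < e / 2"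
      using e by (intro order_tendstoD(2)[of _ 0]) auto
    then obtain N where N: "\<And>n. N \<le> n \<Longrightarrow> (real (Suc k))\<^sup>2 * (\<integral>x. r x * (h n x)\<^sup>2 \<partial>lborel) < e / 2"
      by (auto simp: eventually_sequentially)
    have "norm ((\<integral>x. indicator S x * \<bar>h n x\<bar> \<partial>lborel) - 0) < e" if "N \<le> n" for n
    proof -
      have "(\<integral>x. indicator S x * \<bar>h n x\<bar> \<partial>lborel)
        \<le> (\<integral>x. indicator S x * small k x + (real (Suc k))\<^sup>2 * (r x * (h n x)\<^sup>2) \<partial>lborel)"
        by (intro integral_mono split intSh Bochner_Integration.integrable_add intS small_bm
            integrable_mult_right int)
      also have "\<dots> = (\<integral>x. indicator S x * small k x \<partial>lborel) + (real (Suc k))\<^sup>2 * (\<integral>x. r x * (h n x)\<^sup>2 \<partial>lborel)"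
        using intS[OF small_bm] int by (simp del: of_nat_Suc)
      also have "\<dots> < e" using k N[OF that] by linarith
      finally have "(\<integral>x. indicator S x * \<bar>h n x\<bar> \<partial>lborel) < e" .
      moreover have "0 \<le> (\<integral>x. indicator S x * \<bar>h n x\<bar> \<partial>lborel)"
        by (intro Bochner_Integration.integral_nonneg) auto
      ultimately show ?thesis by simp
    qed
    then show "\<exists>N. \<forall>n\<ge>N. norm ((\<integral>x. indicator S x * \<bar>h n x\<bar> \<partial>lborel) - 0) < e" by blast
  qed
  then have "L1_null (\<lambda>n x. indicator S x * \<bar>h n x\<bar>)" by (intro L1_nullI intSh) auto
  then show ?thesis by (rule L1_null_dominated) (auto simp: abs_mult)
qed

section \<open>Energy along the iterates of the transition operator\<close>

context triangular_cell
begin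

lemma inner_w_add_left:
  assumes "bounded_measurable f" "bounded_measurable g" "bounded_measurable h"
  shows "inner_w (\<lambda>x. f x + c * g x) h = inner_w f h + c * inner_w g h"
proof -
  have "integrable lborel (\<lambda>x. w x * (f x * h x))" "integrable lborel (\<lambda>x. w x * (g x * h x))"
    by (intro w_integrable bounded_measurable_mult assms)+
  then show ?thesis by (simp add: inner_w_def algebra_simps)
qed

lemma inner_w_nonneg: "0 \<le> inner_w f f"
  unfolding inner_w_def by (rule Bochner_Integration.integral_nonneg) (simp add: w_nonneg)

lemma inner_w_add_add:
  assumes f: "bounded_measurable f" and g: "bounded_measurable g"
  shows "inner_w (\<lambda>x. f x + c * g x) (\<lambda>x. f x + c * g x)
    = inner_w f f + 2 * c * inner_w f g + c\<^sup>2 * inner_w g g"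
proof -
  have "bounded_measurable (\<lambda>x. f x + c * g x)"
    by (intro bounded_measurable_add bounded_measurable_mult bounded_measurable_const f g)
  from inner_w_add_left[OF f g this, of c] show ?thesis
    using inner_w_add_left[OF f g f, of c] inner_w_add_left[OF f g g, of c] inner_w_commute[of g f]
      inner_w_commute[of f "\<lambda>x. f x + c * g x"] inner_w_commute[of g "\<lambda>x. f x + c * g x"]
    by (simp add: algebra_simps power2_eq_square)
qed

text \<open>A positive upper bound B replaces the squared norm of g: the application has g varying
  with n and a uniform bound, and dividing by B is always possible.\<close>

lemma inner_w_Cauchy_Schwarz:
  assumes f: "bounded_measurable f" and g: "bounded_measurable g"
    and "inner_w g g \<le> B" "0 < B"
  shows "\<bar>inner_w f g\<bar>\<^sup>2 \<le> B * inner_w f f"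
proof -
  \<comment> \<open>The minimiser of the quadratic in t after its leading coefficient is replaced by
    B.\<close>
  define t where "t = - inner_w f g / B"
  have "0 \<le> inner_w f f + 2 * t * inner_w f g + t\<^sup>2 * inner_w g g"
    using inner_w_nonneg inner_w_add_add[OF f g, of t] by metis
  also have "\<dots> \<le> inner_w f f + 2 * t * inner_w f g + t\<^sup>2 * B"
    using assms(3) by (intro add_left_mono mult_left_mono) auto
  also have "\<dots> = inner_w f f - (inner_w f g)\<^sup>2 / B"
    using assms(4) by (simp add: t_def field_simps power2_eq_square)
  finally show ?thesis using assms(4) by (simp add: field_simps)
qed

text \<open>The Dirichlet form is nonnegative; at g = P f it equals the difference of the two
  squared norms.\<close>

lemma P_contraction:
  assumes f: "bounded_measurable f"
  shows "inner_w (P f) (P f) \<le> inner_w f f"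
proof -
  have "0 \<le> inner_w f f + inner_w (P f) (P f) - 2 * inner_w (P f) (P f)"
    unfolding dirichlet_form[OF f bounded_measurable_P[OF f], symmetric]
    using q_nonneg by (intro add_nonneg_nonneg Bochner_Integration.integral_nonneg) auto
  then show ?thesis by simp
qed

lemma P_linear: "P (\<lambda>x. f x + c * g x) = (\<lambda>x. P f x + c * P g x)"
  by (auto simp: P_def algebra_simps)

definition iter :: "(real \<Rightarrow> real) \<Rightarrow> nat \<Rightarrow> real \<Rightarrow> real" where
  "iter f n = (P ^^ n) f"

lemma iter_Suc: "iter f (Suc n) = P (iter f n)" and iter_0: "iter f 0 = f"
  by (simp_all add: iter_def)

lemma iter_bound: "(\<And>x. \<bar>f x\<bar> \<le> C) \<Longrightarrow> \<bar>iter f n x\<bar> \<le> C"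
proof (induction n arbitrary: x)
  case (Suc n)
  then show ?case by (simp add: iter_Suc P_bound)
qed (simp add: iter_0)

lemma bounded_measurable_iter: "bounded_measurable f \<Longrightarrow> bounded_measurable (iter f n)"
  by (induction n) (auto simp: iter_Suc iter_0 intro: bounded_measurable_P)

lemma iter_bounded_measurable_comb:
  "bounded_measurable f \<Longrightarrow> bounded_measurable (\<lambda>x. iter f m x + c * iter f n x)"
  by (intro bounded_measurable_add bounded_measurable_mult bounded_measurable_const bounded_measurable_iter)

text \<open>Symmetry moves the factors P across one at a time, so the inner product of two iterates
  depends only on the sum of the exponents.\<close>

lemma inner_w_iter:
  assumes "bounded_measurable f"
  shows "inner_w (iter f m) (iter f (n + k)) = inner_w (iter f (m + k)) (iter f n)"
proof (induction k arbitrary: n)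
  case (Suc k)
  show ?case
    using Suc[of "Suc n"] P_symmetric[OF bounded_measurable_iter[OF assms, of "m+k"] bounded_measurable_iter[OF assms, of n]]
    by (simp add: iter_Suc)
qed simp

text \<open>The cross term of P^n f and P^(n+2) f is again a squared norm, that of P^(n+1) f. The
  square is therefore a second difference of the decreasing nonnegative, hence convergent, sequence
  of squared norms.\<close>

lemma iter_second_difference:
  assumes f: "bounded_measurable f"
  shows "(\<lambda>n. inner_w (\<lambda>x. iter f n x + (-1) * iter f (n + 2) x)
                    (\<lambda>x. iter f n x + (-1) * iter f (n + 2) x)) \<longlonglongrightarrow> 0"
proof -
  define b where "b n = inner_w (iter f n) (iter f n)" for n
  note bm = bounded_measurable_iter[OF f]
  have "decseq b"
    unfolding decseq_Suc_iff b_def iter_Suc using P_contraction[OF bm] by auto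
  then obtain L where L: "b \<longlonglongrightarrow> L"
    using decseq_convergent[of b 0] inner_w_nonneg unfolding b_def by blast
  have "inner_w (\<lambda>x. iter f n x + (-1) * iter f (n + 2) x) (\<lambda>x. iter f n x + (-1) * iter f (n + 2) x)
    = b n - 2 * b (n + 1) + b (n + 2)" for n
    unfolding inner_w_add_add[OF bm bm] b_def
    using inner_w_iter[OF f, of n "n + 1" 1] by simp
  moreover have "(\<lambda>n. b n - 2 * b (n + 1) + b (n + 2)) \<longlonglongrightarrow> L - 2 * L + L"
    by (intro tendsto_intros L LIMSEQ_ignore_initial_segment)
  ultimately show ?thesis by simp
qed

text \<open>As \<open>g\<^sub>n = P\<^sup>n f + s P\<^sup>n\<^sup>+\<^sup>1 f\<close> satisfies \<open>g\<^sub>n - s P g\<^sub>n = P\<^sup>n f - P\<^sup>n\<^sup>+\<^sup>2 f\<close> when \<open>s\<^sup>2 = 1\<close>,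
  its Dirichlet energy tends to zero.\<close>

definition sym_iter :: "real \<Rightarrow> (real \<Rightarrow> real) \<Rightarrow> nat \<Rightarrow> real \<Rightarrow> real" where
  "sym_iter s f n x = iter f n x + s * iter f (Suc n) x"

lemma bounded_measurable_sym_iter: "bounded_measurable f \<Longrightarrow> bounded_measurable (sym_iter s f n)"
  unfolding sym_iter_def[abs_def] by (rule iter_bounded_measurable_comb)

text \<open>The total energy \<open>D n\<close> is twice the inner product of P^n f - P^(n+2) f with
  \<open>g n\<close>. Cauchy-Schwarz applies since the norms of \<open>g n\<close> stay bounded, and
  each single term is at most the total because all are nonnegative.\<close>

lemma dirichlet_sym_iter:
  assumes f: "bounded_measurable f" and s: "s = 1 \<or> s = -1"
  defines "g \<equiv> sym_iter s f"
  shows "(\<lambda>n. \<integral>x. q1 x * (g n (x + 2*\<alpha>) - s * g n x)\<^sup>2 \<partial>lborel) \<longlonglongrightarrow> 0"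
    and "(\<lambda>n. \<integral>x. q2 x * (g n (2*pi - 4*\<alpha> - x) - s * g n x)\<^sup>2 \<partial>lborel) \<longlonglongrightarrow> 0"
    and "(\<lambda>n. \<integral>x. q4 x * (g n (4*\<alpha> - x) - s * g n x)\<^sup>2 \<partial>lborel) \<longlonglongrightarrow> 0"
proof -
  define d where "d n x = iter f n x + (-1) * iter f (n + 2) x" for n x
  note bm = bounded_measurable_iter[OF f]
  have bd: "bounded_measurable (d n)" for n unfolding d_def[abs_def] by (rule iter_bounded_measurable_comb[OF f])
  have bg: "bounded_measurable (g n)" for n unfolding g_def by (rule bounded_measurable_sym_iter[OF f])
  have bsg: "bounded_measurable (\<lambda>x. s * g n x)" for n
    by (intro bounded_measurable_mult bounded_measurable_const bg)
  have s2: "s * s = 1" using s by auto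
  define D where "D n = inner_w (g n) (g n) + inner_w (\<lambda>x. s * g n x) (\<lambda>x. s * g n x)
    - 2 * inner_w (P (g n)) (\<lambda>x. s * g n x)" for n
  have D: "D n = 2 * inner_w (d n) (g n)" for n
  proof -
    have 1: "d n = (\<lambda>x. g n x + (-s) * P (g n) x)"
      using s2 by (auto simp: d_def g_def sym_iter_def[abs_def] P_linear iter_Suc algebra_simps mult.assoc[symmetric])
    have "inner_w (d n) (g n) = inner_w (g n) (g n) - s * inner_w (P (g n)) (g n)"
      unfolding 1 by (subst inner_w_add_left) (auto intro: bg bounded_measurable_P)
    moreover have "inner_w (P (g n)) (\<lambda>x. s * g n x) = s * inner_w (P (g n)) (g n)"
      by (simp add: inner_w_def mult.left_commute[of _ s])
    moreover have "inner_w (\<lambda>x. s * g n x) (\<lambda>x. s * g n x) = inner_w (g n) (g n)"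
      using s by (auto simp: inner_w_def)
    ultimately show ?thesis by (simp add: D_def)
  qed
  \<comment> \<open>The squared norm of a sum is at most twice the sum of the squared norms, and
    iterates do not exceed f in norm: hence the 4. The summand 1 makes B positive.\<close>
  define B where "B = 4 * inner_w f f + 1"
  have le: "inner_w (iter f n) (iter f n) \<le> inner_w f f" for n
    by (induction n) (auto simp: iter_0 iter_Suc intro: order_trans P_contraction bm)
  have gg: "inner_w (g n) (g n) \<le> B" for n
  proof -
    have "inner_w (g n) (g n) = inner_w (iter f n) (iter f n) + 2 * s * inner_w (iter f n) (iter f (Suc n))
        + inner_w (iter f (Suc n)) (iter f (Suc n))"
      unfolding g_def sym_iter_def[abs_def] using inner_w_add_add[OF bm bm, where c=s] s by auto
    moreover have "0 \<le> inner_w (iter f n) (iter f n) - 2 * s * inner_w (iter f n) (iter f (Suc n))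
        + inner_w (iter f (Suc n)) (iter f (Suc n))"
      using inner_w_nonneg[of "\<lambda>x. iter f n x + (-s) * iter f (Suc n) x"] s
      unfolding inner_w_add_add[OF bm bm] by auto
    ultimately show ?thesis using le[of n] le[of "Suc n"] by (simp add: B_def)
  qed
  have "0 < B" using inner_w_nonneg[of f] by (simp add: B_def)
  have "(\<lambda>n. \<bar>inner_w (d n) (g n)\<bar>) \<longlonglongrightarrow> 0"
    by (rule power2_tendsto_0_imp_abs[of _ B "\<lambda>n. inner_w (d n) (d n)"])
       (use inner_w_Cauchy_Schwarz[OF bd bg gg \<open>0 < B\<close>] iter_second_difference[OF f] in \<open>auto simp: d_def[abs_def]\<close>)
  then have "(\<lambda>n. 2 * inner_w (d n) (g n)) \<longlonglongrightarrow> 0"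
    by (intro tendsto_mult_right_zero) (rule tendsto_rabs_zero_cancel)
  then have lim: "D \<longlonglongrightarrow> 0" using D by presburger
  let ?I1 = "\<lambda>n. \<integral>x. q1 x * (g n (x + 2*\<alpha>) - s * g n x)\<^sup>2 \<partial>lborel"
  let ?I2 = "\<lambda>n. \<integral>x. q2 x * (g n (2*pi - 4*\<alpha> - x) - s * g n x)\<^sup>2 \<partial>lborel"
  let ?I3 = "\<lambda>n. \<integral>x. q3 x * (g n (x - 2*\<alpha>) - s * g n x)\<^sup>2 \<partial>lborel"
  let ?I4 = "\<lambda>n. \<integral>x. q4 x * (g n (4*\<alpha> - x) - s * g n x)\<^sup>2 \<partial>lborel"
  have nn: "0 \<le> ?I1 n" "0 \<le> ?I2 n" "0 \<le> ?I3 n" "0 \<le> ?I4 n" for n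
    using q_nonneg by (auto intro!: Bochner_Integration.integral_nonneg)
  have sum: "?I1 n + ?I2 n + ?I3 n + ?I4 n = D n" for n
    unfolding D_def by (rule dirichlet_form[OF bg bsg])
  have sandwich: "I \<longlonglongrightarrow> 0" if "\<And>n. 0 \<le> I n" "\<And>n. I n \<le> D n" for I
    using that by (intro tendsto_sandwich[OF _ _ tendsto_const lim]) auto
  have "?I1 n \<le> D n" "?I2 n \<le> D n" "?I4 n \<le> D n" for n
    using nn[of n] sum[of n] by linarith+
  then show "?I1 \<longlonglongrightarrow> 0" "?I2 \<longlonglongrightarrow> 0" "?I4 \<longlonglongrightarrow> 0"
    using nn by (intro sandwich; simp)+
qed

lemma sym_iter_bound:
  assumes "\<And>x. \<bar>f x\<bar> \<le> C" "s = 1 \<or> s = -1"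
  shows "\<bar>sym_iter s f n x\<bar> \<le> 2 * C"
  using iter_bound[where f=f and n=n and x=x, OF assms(1)] iter_bound[where f=f and n="Suc n" and x=x, OF assms(1)] assms(2)
  by (auto simp: sym_iter_def)

lemma sym_iter_almost_invariant:
  assumes f: "bounded_measurable f" and s: "s = 1 \<or> s = -1"
  defines "g \<equiv> sym_iter s f"
  shows "L1_null (\<lambda>n x. indicator {0<..<pi - 2*\<alpha>} x * (g n (x + 2*\<alpha>) - s * g n x))"
    and "L1_null (\<lambda>n x. indicator {pi - 2*\<alpha><..<pi - \<alpha>} x * (g n (2*pi - 4*\<alpha> - x) - s * g n x))"
    and "L1_null (\<lambda>n x. indicator {\<alpha><..<2*\<alpha>} x * (g n (4*\<alpha> - x) - s * g n x))"
proof -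
  obtain C where C: "\<And>x. \<bar>f x\<bar> \<le> C" using f by (auto simp: bounded_measurable_def)
  have bg: "bounded_measurable (g n)" for n unfolding g_def by (rule bounded_measurable_sym_iter[OF f])
  note [measurable] = bounded_measurableD[OF bg]
  have bound: "\<bar>g n y - s * g n x\<bar> \<le> 4 * C" for n x y
    using sym_iter_bound[where f=f and n=n and x=x, OF C s] sym_iter_bound[where f=f and n=n and x=y, OF C s] s by (auto simp: g_def)
  note intro = q_integrable bounded_measurable_power2 bounded_measurable_diff bounded_measurable_mult
    bounded_measurable_const bounded_measurable_shift[OF bg] bg
  show "L1_null (\<lambda>n x. indicator {0<..<pi - 2*\<alpha>} x * (g n (x + 2*\<alpha>) - s * g n x))"
    using \<alpha>_pos dirichlet_sym_iter(1)[OF f s]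
    by (intro L1_null_remove_weight[of q1 _ _ 0 pi "4*C"] bound intro) (auto simp: q_nonneg q_pos g_def[symmetric])
  show "L1_null (\<lambda>n x. indicator {pi - 2*\<alpha><..<pi - \<alpha>} x * (g n (2*pi - 4*\<alpha> - x) - s * g n x))"
    using \<alpha>_pos \<alpha>_less dirichlet_sym_iter(2)[OF f s]
    by (intro L1_null_remove_weight[of q2 _ _ 0 pi "4*C"] bound intro) (auto simp: q_nonneg q_pos g_def[symmetric])
  show "L1_null (\<lambda>n x. indicator {\<alpha><..<2*\<alpha>} x * (g n (4*\<alpha> - x) - s * g n x))"
    using \<alpha>_pos \<alpha>_less dirichlet_sym_iter(3)[OF f s]
    by (intro L1_null_remove_weight[of q4 _ _ 0 pi "4*C"] bound intro) (auto simp: q_nonneg q_pos g_def[symmetric])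
qed

end

section \<open>Extension to the circle\<close>

text \<open>The \<open>2\<pi>\<close>-periodic extension of a function on \<open>[0,\<pi>]\<close>, even for \<open>s = 1\<close> and odd
  for \<open>s = -1\<close>; \<open>arccos (cos x)\<close> folds the line onto \<open>[0,\<pi>]\<close>.\<close>

definition circle_ext :: "real \<Rightarrow> (real \<Rightarrow> real) \<Rightarrow> real \<Rightarrow> real" where
  "circle_ext s g x = (if sin x < 0 then s else 1) * g (arccos (cos x))"

lemma circle_ext_periodic: "circle_ext s g (x + 2*pi) = circle_ext s g x"
  by (simp add: circle_ext_def)

lemma circle_ext_upper: "0 \<le> x \<Longrightarrow> x \<le> pi \<Longrightarrow> circle_ext s g x = g x"
  using sin_ge_zero[of x] by (simp add: circle_ext_def arccos_cos)

lemma circle_ext_lower: "-pi < x \<Longrightarrow> x < 0 \<Longrightarrow> circle_ext s g x = s * g (-x)"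
  using sin_gt_zero[of "-x"] by (simp add: circle_ext_def arccos_cos2)

lemma circle_ext_beyond_pi: "pi < x \<Longrightarrow> x < 2*pi \<Longrightarrow> circle_ext s g x = s * g (2*pi - x)"
  using circle_ext_periodic[of s g "x - 2*pi"] circle_ext_lower[of "x - 2*pi" s g] by simp

lemma bounded_measurable_circle_ext:
  assumes "bounded_measurable g"
  shows "bounded_measurable (circle_ext s g)"
proof -
  have "continuous_on UNIV (\<lambda>x::real. arccos (cos x))"
    by (intro continuous_intros) auto
  then have "(\<lambda>x::real. arccos (cos x)) \<in> borel_measurable borel"
    by (rule borel_measurable_continuous_onI)
  then have 1: "bounded_measurable (\<lambda>x. g (arccos (cos x)))"
    by (rule bounded_measurable_compose[OF assms])
  have "bounded_measurable (\<lambda>x. if sin x < 0 then s else 1)"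
    by (rule bounded_measurableI[of _ "max \<bar>s\<bar> 1"]) auto
  from bounded_measurable_mult[OF this 1] show ?thesis by (simp add: circle_ext_def[abs_def])
qed

lemma circle_ext_bound:
  assumes "\<And>x. \<bar>g x\<bar> \<le> C" "s = 1 \<or> s = -1"
  shows "\<bar>circle_ext s g x\<bar> \<le> C"
  using assms by (auto simp: circle_ext_def)

section \<open>The billiard maps as one rotation\<close>

context triangular_cell
begin

text \<open>Each tau_i costs a factor s. Away from 0 and pi the rotation is one step of
  \<open>tau1\<close> or \<open>tau3\<close> under the fold. Close to 0 and pi it crosses to the
  other half circle, and its fold is a composition of two maps tau_i: these cost s^2 = 1, and the
  parity of the extension supplies the one factor s. This is why s = 1 needs the even and s = -1 the
  odd extension.\<close>

lemma circle_ext_almost_invariant: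
  assumes f: "bounded_measurable f" and s: "s = 1 \<or> s = -1"
  defines "G \<equiv> \<lambda>n. circle_ext s (sym_iter s f n)"
  shows "L1_null (\<lambda>n x. indicator {-pi..pi} x * (G n (x + 2*\<alpha>) - s * G n x))"
proof -
  define g where "g = sym_iter s f"
  have bg: "bounded_measurable (g n)" for n unfolding g_def by (rule bounded_measurable_sym_iter[OF f])
  have bG: "bounded_measurable (G n)" for n
    unfolding G_def using bounded_measurable_circle_ext[OF bg] by (simp add: g_def)
  note [measurable] = bounded_measurableD[OF bG]
  define T1 where "T1 n x = indicator {0<..<pi - 2*\<alpha>} x * (g n (x + 2*\<alpha>) - s * g n x)" for n x
  define T2 where "T2 n x = indicator {pi - 2*\<alpha><..<pi - \<alpha>} x * (g n (2*pi - 4*\<alpha> - x) - s * g n x)" for n x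
  define T4 where "T4 n x = indicator {\<alpha><..<2*\<alpha>} x * (g n (4*\<alpha> - x) - s * g n x)" for n x
  have T: "L1_null T1" "L1_null T2" "L1_null T4"
    unfolding T1_def[abs_def] T2_def[abs_def] T4_def[abs_def] g_def
    by (rule sym_iter_almost_invariant[OF f s])+
  note shift = L1_null_affine[where c=1, simplified] and reflect = L1_null_affine[where c="-1", simplified]
  define lower where "lower n x = \<bar>T1 n (-2*\<alpha> - x)\<bar> + \<bar>\<bar>\<bar>T1 n (2*\<alpha> + x)\<bar> + \<bar>T4 n (0 - x)\<bar>\<bar>
      + \<bar>\<bar>T1 n (0 - x)\<bar> + \<bar>T4 n (2*\<alpha> + x)\<bar>\<bar>\<bar>" for n x
  define upper where "upper n x = \<bar>T1 n x\<bar> + \<bar>\<bar>\<bar>T2 n x\<bar> + \<bar>T1 n (2*pi - 4*\<alpha> - x)\<bar>\<bar>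
      + \<bar>\<bar>T2 n (2*pi - 2*\<alpha> - x)\<bar> + \<bar>T1 n (-2*\<alpha> + x)\<bar>\<bar>\<bar>" for n x
  have "L1_null lower" "L1_null upper"
    unfolding lower_def[abs_def] upper_def[abs_def]
    by (intro L1_null_abs_add shift reflect T)+
  then have "L1_null (\<lambda>n x. \<bar>lower n x\<bar> + \<bar>upper n x\<bar>)" by (rule L1_null_abs_add)
  then show ?thesis
  proof (rule L1_null_dominated)
    fix n
    \<comment> \<open>The division points of the cases: finitely many, hence a null set.\<close>
    define B where "B = {-pi, -2*\<alpha>, -\<alpha>, 0, pi - 2*\<alpha>, pi - \<alpha>, pi}"
    have "AE x in lborel. x \<notin> B"
      by (rule AE_not_in) (simp add: B_def finite_imp_null_set_lborel)
    then show "AE x in lborel. \<bar>indicator {-pi..pi} x * (G n (x + 2*\<alpha>) - s * G n x)\<bar>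
      \<le> \<bar>\<bar>lower n x\<bar> + \<bar>upper n x\<bar>\<bar>"
    proof (rule eventually_mono)
      fix x assume x: "x \<notin> B"
      have nonneg: "0 \<le> lower n x" "0 \<le> upper n x" by (auto simp: lower_def upper_def)
      have G: "G n y = circle_ext s (g n) y" for y by (simp add: G_def g_def)
      \<comment> \<open>In cases 1 and 4 the folded angle makes one step. Otherwise it takes two:
        \<open>tau4\<close> then \<open>tau3\<close> in case 2, \<open>tau1\<close> then
        \<open>tau4\<close> in case 3, \<open>tau2\<close> then \<open>tau1\<close> in case 5,
        \<open>tau3\<close> then \<open>tau2\<close> in case 6. The values at the intermediate point
        cancel; a step of \<open>tau3\<close> is written as \<open>T1\<close> at its target.\<close>
      consider (out) "x \<notin> {-pi..pi}" | (1) "-pi < x" "x < -2*\<alpha>" | (2) "-2*\<alpha> < x" "x < -\<alpha>"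
        | (3) "-\<alpha> < x" "x < 0" | (4) "0 < x" "x < pi - 2*\<alpha>"
        | (5) "pi - 2*\<alpha> < x" "x < pi - \<alpha>" | (6) "pi - \<alpha> < x" "x < pi"
        using x by (fastforce simp: B_def)
      then have "\<bar>indicator {-pi..pi} x * (G n (x + 2*\<alpha>) - s * G n x)\<bar> \<le> lower n x + upper n x"
      proof cases
        case out
        then show ?thesis using nonneg by auto
      next
        case 1
        have "G n (x + 2*\<alpha>) - s * G n x = - T1 n (-2*\<alpha> - x)"
          using 1 \<alpha>_pos s by (auto simp: G circle_ext_lower T1_def minus_diff_commute)
        then have "\<bar>G n (x + 2*\<alpha>) - s * G n x\<bar> \<le> lower n x" by (simp add: lower_def)
        then show ?thesis using nonneg by (simp add: indicator_def)
      next
        case 2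
        have "G n (x + 2*\<alpha>) - s * G n x = s * (T4 n (0 - x) - T1 n (2*\<alpha> + x))"
          using 2 \<alpha>_pos \<alpha>_less s
          by (auto simp: G circle_ext_lower circle_ext_upper T1_def T4_def algebra_simps)
        then have "\<bar>G n (x + 2*\<alpha>) - s * G n x\<bar> \<le> lower n x" using s by (auto simp: lower_def)
        then show ?thesis using nonneg by (simp add: indicator_def)
      next
        case 3
        have "G n (x + 2*\<alpha>) - s * G n x = s * (T1 n (0 - x) - T4 n (2*\<alpha> + x))"
          using 3 \<alpha>_pos \<alpha>_less s
          by (auto simp: G circle_ext_lower circle_ext_upper T1_def T4_def algebra_simps)
        then have "\<bar>G n (x + 2*\<alpha>) - s * G n x\<bar> \<le> lower n x" using s by (auto simp: lower_def)
        then show ?thesis using nonneg by (simp add: indicator_def)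
      next
        case 4
        have "G n (x + 2*\<alpha>) - s * G n x = T1 n x"
          using 4 \<alpha>_pos by (auto simp: G circle_ext_upper T1_def)
        then have "\<bar>G n (x + 2*\<alpha>) - s * G n x\<bar> \<le> upper n x" by (simp add: upper_def)
        then show ?thesis using nonneg by (simp add: indicator_def)
      next
        case 5
        have "G n (x + 2*\<alpha>) - s * G n x = s * T1 n (2*pi - 4*\<alpha> - x) + T2 n x"
          using 5 \<alpha>_pos \<alpha>_less s
          by (auto simp: G circle_ext_beyond_pi circle_ext_upper T1_def T2_def algebra_simps)
        then have "\<bar>G n (x + 2*\<alpha>) - s * G n x\<bar> \<le> upper n x" using s by (auto simp: upper_def)
        then show ?thesis using nonneg by (simp add: indicator_def)
      next
        case 6
        have "G n (x + 2*\<alpha>) - s * G n x = - T2 n (2*pi - 2*\<alpha> - x) - s * T1 n (-2*\<alpha> + x)"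
          using 6 \<alpha>_pos \<alpha>_less s
          by (auto simp: G circle_ext_beyond_pi circle_ext_upper T1_def T2_def algebra_simps)
        then have "\<bar>G n (x + 2*\<alpha>) - s * G n x\<bar> \<le> upper n x" using s by (auto simp: upper_def)
        then show ?thesis using nonneg by (simp add: indicator_def)
      qed
      then show "\<bar>indicator {-pi..pi} x * (G n (x + 2*\<alpha>) - s * G n x)\<bar> \<le> \<bar>\<bar>lower n x\<bar> + \<bar>upper n x\<bar>\<bar>"
        using nonneg by simp
    qed
  qed measurable
qed

end

text \<open>An interval [-L,L] with L at least pi and its two translates by 2*pi cover
  [-(L + 2*pi), L + 2*pi], so finitely many periods suffice for any bounded interval.\<close>

lemma L1_null_periodic_local:
  assumes L1: "L1_null (\<lambda>n x. indicator {-pi..pi} x * e n x)"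
    and meas [measurable]: "\<And>n. e n \<in> borel_measurable borel"
    and per: "\<And>n x. e n (x + 2*pi) = e n x"
  shows "L1_null (\<lambda>n x. indicator {a..b} x * e n x)"
proof -
  have per': "e n (2*pi + x) = e n x" "e n (x - 2*pi) = e n x" for n x
    using per[of n x] per[of n "x - 2*pi"] by (simp_all add: add.commute)
  have "L1_null (\<lambda>n x. indicator {- ((2 * real N + 1) * pi)..(2 * real N + 1) * pi} x * e n x)" for N
  proof (induction N)
    case 0
    then show ?case using L1 by simp
  next
    case (Suc N)
    define L where "L = (2 * real N + 1) * pi"
    have L: "0 \<le> real N * pi" "L = 2 * (real N * pi) + pi" "(2 * real (Suc N) + 1) * pi = L + 2*pi"
      by (auto simp: L_def algebra_simps)
    have Suc_L: "L1_null (\<lambda>n x. indicator {-L..L} x * e n x)" using Suc unfolding L_def .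
    let ?h = "\<lambda>n x. indicator {-L..L} x * e n x"
    have "L1_null (\<lambda>n x. \<bar>?h n x\<bar> + \<bar>\<bar>?h n (2*pi + 1 * x)\<bar> + \<bar>?h n (- (2*pi) + 1 * x)\<bar>\<bar>)"
      using Suc_L by (intro L1_null_abs_add L1_null_affine) auto
    then have "L1_null (\<lambda>n x. indicator {-(L + 2*pi)..L + 2*pi} x * e n x)"
    proof (rule L1_null_dominated)
      fix n
      have "\<bar>indicator {-(L + 2*pi)..L + 2*pi} x * e n x\<bar>
        \<le> \<bar>\<bar>?h n x\<bar> + \<bar>\<bar>?h n (2*pi + 1 * x)\<bar> + \<bar>?h n (- (2*pi) + 1 * x)\<bar>\<bar>\<bar>" for x
      proof -
        consider "x \<notin> {-(L + 2*pi)..L + 2*pi}" | "x \<in> {-L..L}" | "2*pi + x \<in> {-L..L}" | "x - 2*pi \<in> {-L..L}"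
          unfolding atLeastAtMost_iff using L(1,2) pi_gt_zero by linarith
        then show ?thesis by cases (auto simp: per'[of n x] indicator_def)
      qed
      then show "AE x in lborel. \<bar>indicator {-(L + 2*pi)..L + 2*pi} x * e n x\<bar>
        \<le> \<bar>\<bar>?h n x\<bar> + \<bar>\<bar>?h n (2*pi + 1 * x)\<bar> + \<bar>?h n (- (2*pi) + 1 * x)\<bar>\<bar>\<bar>" by simp
    qed measurable
    then show ?case unfolding L(3) .
  qed
  note * = this
  obtain N where "max \<bar>a\<bar> \<bar>b\<bar> < real N * pi" using reals_Archimedean3[OF pi_gt_zero] by blast
  moreover have "(2 * real N + 1) * pi = 2 * (real N * pi) + pi" by (simp add: algebra_simps)
  ultimately have N: "- ((2 * real N + 1) * pi) \<le> a" "b \<le> (2 * real N + 1) * pi"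
    using pi_gt_zero unfolding max_less_iff_conj by linarith+
  show ?thesis
    by (rule L1_null_dominated[OF *[of N]]) (use N in \<open>auto simp: indicator_def\<close>)
qed

lemma integral_periodic:
  fixes h :: "real \<Rightarrow> real"
  assumes h: "bounded_measurable h" and per: "\<And>x. h (x + p) = h x" and p: "0 < p"
  shows "(\<integral>x. indicator {a..<a + p} x * h x \<partial>lborel) = (\<integral>x. indicator {0..<p} x * h x \<partial>lborel)"
proof -
  have per_nat: "h (x + real m * p) = h x" for x m
  proof (induction m)
    case (Suc m)
    then show ?case using per[of "x + real m * p"] by (simp add: algebra_simps)
  qed simp
  have per_int: "h (x + of_int k * p) = h x" for x k
    using per_nat[of x "nat k"] per_nat[of "x + of_int k * p" "nat (-k)"] by (cases "0 \<le> k") auto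
  \<comment> \<open>The representative of a in [0,p): the window [t,t + p) is cut at p and its right
    part moved back to [0,t).\<close>
  define t where "t = p * frac (a / p)"
  define k where "k = \<lfloor>a / p\<rfloor>"
  have a: "a = t + of_int k * p" and t: "0 \<le> t" "t < p"
    using p mult_strict_left_mono[OF frac_lt_1[of "a / p"] p]
    by (auto simp: t_def k_def) (simp add: frac_def field_simps)
  have int: "integrable lborel (\<lambda>x. indicator {c..<d} x * h x)" for c d
    by (rule integrable_bounded_measurable[OF h, of _ c d]) (auto simp: indicator_def)
  have "(\<integral>x. indicator {a..<a + p} x * h x \<partial>lborel) = (\<integral>x. indicator {t..<t + p} x * h x \<partial>lborel)"
    by (subst lborel_integral_real_affine[of 1 _ "of_int k * p"])
       (auto simp: a per_int add.commute[of "of_int k * p"] indicator_def intro!: Bochner_Integration.integral_cong)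
  also have "\<dots> = (\<integral>x. indicator {t..<p} x * h x + indicator {p..<t + p} x * h x \<partial>lborel)"
    using t by (intro Bochner_Integration.integral_cong) (auto simp: indicator_def)
  also have "\<dots> = (\<integral>x. indicator {t..<p} x * h x \<partial>lborel) + (\<integral>x. indicator {p..<t + p} x * h x \<partial>lborel)"
    by (intro Bochner_Integration.integral_add int)
  also have "(\<integral>x. indicator {p..<t + p} x * h x \<partial>lborel) = (\<integral>x. indicator {0..<t} x * h x \<partial>lborel)"
    by (subst lborel_integral_real_affine[of 1 _ p])
       (auto simp: per add.commute[of p] indicator_def intro!: Bochner_Integration.integral_cong)
  also have "(\<integral>x. indicator {t..<p} x * h x \<partial>lborel) + (\<integral>x. indicator {0..<t} x * h x \<partial>lborel)
    = (\<integral>x. indicator {t..<p} x * h x + indicator {0..<t} x * h x \<partial>lborel)"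
    by (intro Bochner_Integration.integral_add[symmetric] int)
  also have "\<dots> = (\<integral>x. indicator {0..<p} x * h x \<partial>lborel)"
    using t by (intro Bochner_Integration.integral_cong) (auto simp: indicator_def)
  finally show ?thesis .
qed

section \<open>Asymptotic invariance under an irrational rotation\<close>

text \<open>Moving the shift from h to the window, the two windows differ only within d of their two
  ends, on a set of length at most 4 * d. The bound is uniform over all h with the same C, which
  allows h to vary with n.\<close>

lemma integral_indicator_shift_close:
  fixes h :: "real \<Rightarrow> real"
  assumes h: "bounded_measurable h" "\<And>x. \<bar>h x\<bar> \<le> C" and d: "\<bar>t - t'\<bar> \<le> d"
  shows "\<bar>(\<integral>x. indicator {a..b} x * h (x + t) \<partial>lborel) - (\<integral>x. indicator {a..b} x * h (x + t') \<partial>lborel)\<bar>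
    \<le> 4 * C * d"
proof -
  have int: "integrable lborel (\<lambda>x. indicator {c..d} x * k x)" if "bounded_measurable k" for c d k
    by (rule integrable_bounded_measurable[OF that, of _ c d]) (auto simp: indicator_def)
  have *: "(\<integral>x. indicator {a..b} x * h (x + t) \<partial>lborel) = (\<integral>x. indicator {a + t..b + t} x * h x \<partial>lborel)" for t
    by (subst (2) lborel_integral_real_affine[of 1 _ t])
       (auto simp: indicator_def add.commute intro!: Bochner_Integration.integral_cong)
  have C: "0 \<le> C" and d0: "0 \<le> d" using h(2)[of 0] d by linarith+
  have "\<bar>(\<integral>x. indicator {a + t..b + t} x * h x \<partial>lborel) - (\<integral>x. indicator {a + t'..b + t'} x * h x \<partial>lborel)\<bar>
    = \<bar>\<integral>x. indicator {a + t..b + t} x * h x - indicator {a + t'..b + t'} x * h x \<partial>lborel\<bar>"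
    by (subst Bochner_Integration.integral_diff) (auto intro: int h)
  also have "\<dots> \<le> (\<integral>x. \<bar>indicator {a + t..b + t} x * h x - indicator {a + t'..b + t'} x * h x\<bar> \<partial>lborel)"
    by (rule integral_abs_bound)
  also have "\<dots> \<le> (\<integral>x. indicator {a + t - d..a + t + d} x * C + indicator {b + t - d..b + t + d} x * C \<partial>lborel)"
  proof (rule integral_mono)
    fix x
    show "\<bar>indicator {a + t..b + t} x * h x - indicator {a + t'..b + t'} x * h x\<bar>
      \<le> indicator {a + t - d..a + t + d} x * C + indicator {b + t - d..b + t + d} x * C"
      using h(2)[of x] C d by (auto simp: indicator_def)
  qed (intro Bochner_Integration.integrable_add Bochner_Integration.integrable_abs
      Bochner_Integration.integrable_diff int h bounded_measurable_const)+
  also have "\<dots> = 4 * C * d"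
  proof -
    have "(\<integral>x. indicator {c - d..c + d} x * C \<partial>lborel) = 2 * d * C" for c :: real
      using d0 by simp
    then show ?thesis
      unfolding Bochner_Integration.integral_add[OF int[OF bounded_measurable_const] int[OF bounded_measurable_const]]
      by (simp only:) simp
  qed
  finally show ?thesis unfolding * .
qed

text \<open>By density of \<open>\<theta>\<nat> + p\<int>\<close>, invariance under one irrational rotation gives asymptotic invariance under
  all rotations; averaging over the rotations then replaces the function by its mean.\<close>

lemma weak_limit_rotation_invariant:
  fixes G :: "nat \<Rightarrow> real \<Rightarrow> real" and \<theta> p :: real
  assumes meas: "\<And>n. G n \<in> borel_measurable borel" and bound: "\<And>n x. \<bar>G n x\<bar> \<le> C"
    and p: "0 < p" and irrational: "\<theta> / p \<notin> \<rat>"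
    and periodic: "\<And>n x. G n (x + p) = G n x"
    and inv: "\<And>a b. L1_null (\<lambda>n x. indicator {a..b} x * (G n (x + \<theta>) - G n x))"
  shows "(\<lambda>n. \<integral>x. indicator {a..b} x * (G n x - (\<integral>y. indicator {0..<p} y * G n y \<partial>lborel) / p) \<partial>lborel) \<longlonglongrightarrow> 0"
proof -
  have bG: "bounded_measurable (G n)" for n using meas bound by (rule bounded_measurableI)
  note [measurable] = meas
  have C: "0 \<le> C" using bound[of 0 0] by linarith
  have int: "integrable lborel (\<lambda>x. indicator {c..d} x * k x)" if "bounded_measurable k" for c d k
    by (rule integrable_bounded_measurable[OF that, of _ c d]) (auto simp: indicator_def)
  have multiples: "L1_null (\<lambda>n x. indicator {a..b} x * (G n (x + real m * \<theta>) - G n x))" for m a b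
  proof (induction m)
    case 0
    then show ?case by (simp add: L1_null_def)
  next
    case (Suc m)
    \<comment> \<open>The next rotation acts at x + m * \<theta>, so the window moves along; hence
      \<open>inv\<close> is required on all intervals.\<close>
    let ?h = "\<lambda>n x. indicator {a + real m * \<theta>..b + real m * \<theta>} x * (G n (x + \<theta>) - G n x)"
    have "L1_null (\<lambda>n x. \<bar>indicator {a..b} x * (G n (x + real m * \<theta>) - G n x)\<bar> + \<bar>?h n (real m * \<theta> + 1 * x)\<bar>)"
      using inv by (intro L1_null_abs_add L1_null_affine Suc) auto
    then show ?case
    proof (rule L1_null_dominated)
      fix n
      have eq: "x + real (Suc m) * \<theta> = (x + real m * \<theta>) + \<theta>" "real m * \<theta> + 1 * x = x + real m * \<theta>" for x
        by (simp_all add: algebra_simps)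
      have "\<bar>indicator {a..b} x * (G n (x + real (Suc m) * \<theta>) - G n x)\<bar>
        \<le> \<bar>\<bar>indicator {a..b} x * (G n (x + real m * \<theta>) - G n x)\<bar> + \<bar>?h n (real m * \<theta> + 1 * x)\<bar>\<bar>" for x
        unfolding eq by (simp add: indicator_def) linarith
      then show "AE x in lborel. \<bar>indicator {a..b} x * (G n (x + real (Suc m) * \<theta>) - G n x)\<bar>
        \<le> \<bar>\<bar>indicator {a..b} x * (G n (x + real m * \<theta>) - G n x)\<bar> + \<bar>?h n (real m * \<theta> + 1 * x)\<bar>\<bar>" by simp
    qed measurable
  qed
  have per_nat: "G n (x + real m * p) = G n x" for n x m
  proof (induction m)
    case (Suc m)
    then show ?case using periodic[of n "x + real m * p"] by (simp add: algebra_simps)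
  qed simp
  have per_int: "G n (x - of_int k * p) = G n x" for n x k
    using per_nat[of n x "nat (-k)"] per_nat[of n "x - of_int k * p" "nat k"] by (cases "0 \<le> k") auto
  define J where "J n t = (\<integral>x. indicator {a..b} x * G n (x + t) \<partial>lborel)" for n t
  have J_lim: "(\<lambda>n. J n t - J n 0) \<longlonglongrightarrow> 0" for t
  proof (rule LIMSEQ_I)
    fix e :: real assume e: "0 < e"
    \<comment> \<open>Makes the error 4 * C * d of the shift lemma less than e / 2, even for C =
      0.\<close>
    define d where "d = e / (8 * (C + 1))"
    have d: "0 < d" "4 * C * d < e / 2"
      using e C by (auto simp: d_def field_simps)
    obtain k h where k: "k > 0" "\<bar>of_int k * (\<theta> / p) - of_int h - t / p\<bar> < d / p"
      by (rule sequence_of_fractional_parts_is_dense[OF irrational, of "d / p" "t / p"])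
         (use d(1) p in auto)
    \<comment> \<open>A point of the dense set of multiples of \<theta> modulo p. As k > 0,
      \<open>nat k\<close> is faithful and \<open>multiples\<close> applies; the part
      \<open>h * p\<close> disappears by periodicity.\<close>
    define t' where "t' = real (nat k) * \<theta> - of_int h * p"
    have "of_int k * (\<theta> / p) - of_int h - t / p = (t' - t) / p"
      using k(1) p by (simp add: t'_def field_simps)
    then have "\<bar>of_int k * (\<theta> / p) - of_int h - t / p\<bar> = \<bar>t' - t\<bar> / p"
      using p by (simp add: abs_divide)
    then have t': "\<bar>t - t'\<bar> \<le> d" using k(2) p by (simp add: divide_less_cancel abs_minus_commute)
    have close: "\<bar>J n t - J n t'\<bar> < e / 2" for n
      using integral_indicator_shift_close[where h="G n" and a=a and b=b, OF bG bound t'] d by (simp add: J_def)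
    have "J n t' - J n 0 = (\<integral>x. indicator {a..b} x * (G n (x + real (nat k) * \<theta>) - G n x) \<partial>lborel)" for n
    proof -
      have "G n (x + t') = G n (x + real (nat k) * \<theta>)" for x
        using per_int[of n "x + real (nat k) * \<theta>" h] by (simp add: t'_def algebra_simps)
      then show ?thesis
        using int[OF bG] int[OF bounded_measurable_shift(1)[OF bG]]
        by (simp add: J_def right_diff_distrib)
    qed
    then have "(\<lambda>n. J n t' - J n 0) \<longlonglongrightarrow> 0" using L1_null_imp_integral[OF multiples] by simp
    then obtain N where N: "\<And>n. N \<le> n \<Longrightarrow> \<bar>J n t' - J n 0\<bar> < e / 2"
      using LIMSEQ_D[of "\<lambda>n. J n t' - J n 0" 0 "e / 2"] e by auto
    have "norm (J n t - J n 0 - 0) < e" if "N \<le> n" for n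
      using close[of n] N[OF that] unfolding real_norm_def by linarith
    then show "\<exists>N. \<forall>n\<ge>N. norm (J n t - J n 0 - 0) < e" by blast
  qed
  define l :: real where "l = (\<integral>x. indicator {a..b} x \<partial>lborel)"
  have J_bound: "\<bar>J n t\<bar> \<le> C * l" for n t
  proof -
    have "\<bar>J n t\<bar> \<le> (\<integral>x. \<bar>indicator {a..b} x * G n (x + t)\<bar> \<partial>lborel)"
      unfolding J_def by (rule integral_abs_bound)
    also have "\<dots> \<le> (\<integral>x. indicator {a..b} x * C \<partial>lborel)"
      using bound by (intro integral_mono int Bochner_Integration.integrable_abs
          bounded_measurable_shift(1)[OF bG] bounded_measurable_const) (auto simp: indicator_def)
    also have "\<dots> = C * l" by (simp add: l_def)
    finally show ?thesis .
  qed
  have J_meas [measurable]: "J n \<in> borel_measurable borel" for n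
    unfolding J_def[abs_def] by measurable
  have bJ: "bounded_measurable (J n)" for n
    using J_meas J_bound by (rule bounded_measurableI)
  define M where "M n = (\<integral>y. indicator {0..<p} y * G n y \<partial>lborel)" for n
  have intp: "integrable lborel (\<lambda>x. indicator {0..<p} x * k x)" if "bounded_measurable k" for k
    by (rule integrable_bounded_measurable[OF that, of _ 0 p]) (auto simp: indicator_def)
  \<comment> \<open>Averaging over one period of shifts: by Fubini the average of
    \<open>J n t\<close> sees x only through a full period of \<open>G n\<close>, hence yields the
    mean.\<close>
  have "(\<lambda>n. \<integral>t. indicator {0..<p} t * (J n t - J n 0) \<partial>lborel) \<longlonglongrightarrow> (\<integral>t. 0 \<partial>(lborel::real measure))"
  proof (rule integral_dominated_convergence[where w="\<lambda>t. indicator {0..<p} t * (2 * C * l)"])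
    show "AE t in lborel. (\<lambda>n. indicator {0..<p} t * (J n t - J n 0)) \<longlonglongrightarrow> 0"
      by (intro AE_I2 tendsto_mult_right_zero J_lim)
    show "integrable lborel (\<lambda>t. indicator {0..<p} t * (2 * C * l))"
      by (intro intp bounded_measurable_const)
    have "\<bar>J n t - J n 0\<bar> \<le> 2 * C * l" for n t using J_bound[of n t] J_bound[of n 0] by simp
    then show "AE t in lborel. norm (indicator {0..<p} t * (J n t - J n 0)) \<le> indicator {0..<p} t * (2 * C * l)"
      for n by (auto simp: indicator_def)
  qed measurable
  moreover have "(\<integral>t. indicator {0..<p} t * (J n t - J n 0) \<partial>lborel) = l * M n - p * J n 0" for n
  proof -
    have "(\<integral>t. indicator {0..<p} t * J n t \<partial>lborel)
      = (\<integral>t. (\<integral>x. indicator {0..<p} t * (indicator {a..b} x * G n (x + t)) \<partial>lborel) \<partial>lborel)"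
      by (simp add: J_def)
    also have "\<dots> = (\<integral>x. (\<integral>t. indicator {0..<p} t * (indicator {a..b} x * G n (x + t)) \<partial>lborel) \<partial>lborel)"
    proof (rule lborel_pair.Fubini_integral)
      show "integrable (lborel \<Otimes>\<^sub>M lborel) (\<lambda>(x, t). indicator {0..<p} t * (indicator {a..b} x * G n (x + t)))"
      proof (rule integrableI_bounded_set[where A="{a..b} \<times> {0..<p}" and B=C])
        show "emeasure (lborel \<Otimes>\<^sub>M lborel) ({a..b} \<times> {0..<p}) < \<infinity>"
          using p by (subst lborel.emeasure_pair_measure_Times)
             (auto simp: emeasure_lborel_Icc_eq ennreal_mult_less_top)
      qed (use bound in \<open>auto simp: indicator_def\<close>)
    qed
    also have "\<dots> = (\<integral>x. indicator {a..b} x * M n \<partial>lborel)"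
    proof (rule Bochner_Integration.integral_cong[OF refl])
      fix x :: real
      have "(\<integral>t. indicator {0..<p} t * G n (x + t) \<partial>lborel) = (\<integral>t. indicator {x..<x + p} t * G n t \<partial>lborel)"
        by (subst (2) lborel_integral_real_affine[of 1 _ x])
           (auto simp: indicator_def intro!: Bochner_Integration.integral_cong)
      also have "\<dots> = M n" unfolding M_def by (rule integral_periodic[OF bG periodic p])
      finally show "(\<integral>t. indicator {0..<p} t * (indicator {a..b} x * G n (x + t)) \<partial>lborel) = indicator {a..b} x * M n"
        by (simp add: mult.left_commute[of _ "indicator {a..b} x"])
    qed
    also have "\<dots> = l * M n" by (simp add: l_def)
    finally show ?thesis using p intp[OF bJ] intp[OF bounded_measurable_const[of "J n 0"]]
      by (simp add: right_diff_distrib)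
  qed
  ultimately have "(\<lambda>n. (- 1 / p) * (l * M n - p * J n 0)) \<longlonglongrightarrow> 0"
    by (intro tendsto_mult_right_zero) simp
  moreover have "(- 1 / p) * (l * M n - p * J n 0) = (\<integral>x. indicator {a..b} x * (G n x - M n / p) \<partial>lborel)" for n
    using p int[OF bG] int[OF bounded_measurable_const[of "M n / p"]]
    by (simp add: right_diff_distrib J_def l_def)
  ultimately show ?thesis by (simp add: M_def)
qed

section \<open>From intervals to integrable test functions\<close>

lemma integrable_mult_bounded_on_interval:
  fixes f g :: "real \<Rightarrow> real"
  assumes f: "integrable lborel f" and g [measurable]: "g \<in> borel_measurable borel" "\<And>x. \<bar>g x\<bar> \<le> C"
  shows "integrable lborel (\<lambda>x. indicator {a..b} x * (f x * g x))"
proof (rule Bochner_Integration.integrable_bound)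
  have C: "0 \<le> C" using g(2)[of 0] by linarith
  show "integrable lborel (\<lambda>x. C * f x)" using f by simp
  have "\<bar>f x\<bar> * \<bar>g x\<bar> \<le> \<bar>f x\<bar> * C" for x using g(2) by (intro mult_left_mono) auto
  then show "AE x in lborel. norm (indicator {a..b} x * (f x * g x)) \<le> norm (C * f x)"
    using C by (auto simp: indicator_def abs_mult mult.commute)
  show "(\<lambda>x. indicator {a..b} x * (f x * g x)) \<in> borel_measurable lborel"
    using borel_measurable_integrable[OF f] by measurable
qed

text \<open>The Borel sets S with vanishing limit form a Dynkin system containing the half-lines, a
  generator stable under intersection; simple functions follow by linearity and all integrable ones
  by approximation in L1, where the uniform bound C keeps the error independent of n.\<close>

lemma weak_null_integrable:
  fixes h :: "nat \<Rightarrow> real \<Rightarrow> real" and \<phi> :: "real \<Rightarrow> real"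
  assumes meas [measurable]: "\<And>n. h n \<in> borel_measurable borel" and bound: "\<And>n x. \<bar>h n x\<bar> \<le> C"
    and interval: "\<And>a b. (\<lambda>n. \<integral>x. indicator {a..b} x * h n x \<partial>lborel) \<longlonglongrightarrow> 0"
    and \<phi>: "integrable lborel \<phi>"
  shows "(\<lambda>n. \<integral>x. indicator {a..b} x * (\<phi> x * h n x) \<partial>lborel) \<longlonglongrightarrow> 0"
proof -
  have C: "0 \<le> C" using bound[of 0 0] by linarith
  have bh: "bounded_measurable (h n)" for n using meas bound by (rule bounded_measurableI)
  have int: "integrable lborel (\<lambda>x. indicator {a..b} x * (indicator S x * h n x))"
    if "S \<in> sets borel" for S n
    using that
    by (intro integrable_bounded_measurable[of _ _ a b] bounded_measurable_mult[OF _ bh] bounded_measurableI[of _ 1])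
       (auto simp: indicator_def)
  have set: "(\<lambda>n. \<integral>x. indicator {a..b} x * (indicator S x * h n x) \<partial>lborel) \<longlonglongrightarrow> 0"
    if "S \<in> sets borel" for S
  proof -
    have mem: "S \<in> sigma_sets UNIV (range (\<lambda>c::real. {..c}))"
      using that by (simp add: borel_eq_atMost)
    have stable: "Int_stable (range (\<lambda>c::real. {..c}))"
      by (auto simp: Int_stable_def)
    have "range (\<lambda>c::real. {..c}) \<subseteq> Pow UNIV" by simp
    from stable this mem show ?thesis
    proof (induction rule: sigma_sets_induct_disjoint)
      case (basic S)
      \<comment> \<open>Cutting [a,b] by a half-line leaves an interval, so the hypothesis on all
        intervals applies.\<close>
      then obtain c where "S = {..c}" by auto
      then have "indicator {a..b} x * (indicator S x * h n x) = indicator {a..min b c} x * h n x" for n x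
        by (auto simp: indicator_def)
      then show ?case using interval[of a "min b c"] by (simp only:)
    next
      case empty
      then show ?case by simp
    next
      case (compl S)
      have S: "S \<in> sets borel" using compl(1) by (simp add: borel_eq_atMost)
      have "(\<lambda>n. (\<integral>x. indicator {a..b} x * h n x \<partial>lborel)
        - (\<integral>x. indicator {a..b} x * (indicator S x * h n x) \<partial>lborel)) \<longlonglongrightarrow> 0 - 0"
        by (intro tendsto_diff interval compl)
      moreover have "(\<integral>x. indicator {a..b} x * h n x \<partial>lborel) - (\<integral>x. indicator {a..b} x * (indicator S x * h n x) \<partial>lborel)
        = (\<integral>x. indicator {a..b} x * (indicator (UNIV - S) x * h n x) \<partial>lborel)" for n
      proof -
        have "integrable lborel (\<lambda>x. indicator {a..b} x * h n x)" using int[of UNIV n] by simp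
        note Bochner_Integration.integral_diff[OF this int[OF S], of n, symmetric]
        then show ?thesis
          by (auto intro!: Bochner_Integration.integral_cong simp: indicator_def)
      qed
      ultimately show ?case by simp
    next
      case (union S)
      have S [measurable]: "S i \<in> sets borel" for i using union(2) by (auto simp: borel_eq_atMost)
      define T where "T i n = (\<integral>x. indicator {a..b} x * (indicator (S i) x * h n x) \<partial>lborel)" for i n
      define L where "L i = C * measure lborel ({a..b} \<inter> S i)" for i
      have fin: "emeasure lborel ({a..b} \<inter> B) < \<infinity>" for B
        by (rule le_less_trans[OF emeasure_mono[of _ "{a..b}"]]) (auto simp: emeasure_lborel_Icc_eq)
      have T_le: "norm (T i n) \<le> L i" for i n
      proof -
        have "\<bar>T i n\<bar> \<le> (\<integral>x. \<bar>indicator {a..b} x * (indicator (S i) x * h n x)\<bar> \<partial>lborel)"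
          unfolding T_def by (rule integral_abs_bound)
        also have "\<dots> \<le> (\<integral>x. C * indicator ({a..b} \<inter> S i) x \<partial>lborel)"
          using fin bound
          by (intro integral_mono Bochner_Integration.integrable_abs int S integrable_mult_right integrable_real_indicator)
             (auto simp: indicator_def)
        also have "\<dots> = L i" by (simp add: L_def)
        finally show ?thesis by simp
      qed
      have "summable (\<lambda>i. measure lborel ({a..b} \<inter> S i))"
        using union(1) fin[of "\<Union>i. S i"]
        by (intro sums_summable[OF measure_UNION])
           (auto simp: disjoint_family_on_def Int_UN_distrib[symmetric] less_top[symmetric])
      then have L: "summable L" unfolding L_def[abs_def] by (rule summable_mult)
      \<comment> \<open>The limit passes under the infinite sum because the bounds
        \<open>L i\<close> do not depend on n and are summable: the sets are disjoint inside a set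
        of finite measure.\<close>
      have "(\<lambda>n. \<Sum>i. T i n) \<longlonglongrightarrow> (\<Sum>i. 0)"
      proof -
        have "(\<lambda>n. T i n) \<longlonglongrightarrow> 0" for i unfolding T_def by (rule union(3))
        moreover have "\<forall>\<^sub>F (i, n) in sequentially \<times>\<^sub>F sequentially. norm (T i n) \<le> L i"
          using T_le by (intro always_eventually) auto
        ultimately show ?thesis using tannerys_theorem[OF _ _ L, of T "\<lambda>_. 0" sequentially] by simp
      qed
      moreover have "(\<Sum>i. T i n) = (\<integral>x. indicator {a..b} x * (indicator (\<Union>i. S i) x * h n x) \<partial>lborel)" for n
      proof -
        have "set_integrable lborel (\<Union>i. S i) (\<lambda>x. indicator {a..b} x * h n x)"
          using int[of "\<Union>i. S i" n] by (simp add: set_integrable_def mult.left_commute)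
        from lebesgue_integral_countable_add[OF _ _ this] show ?thesis
          using union(1)
          by (simp add: T_def set_lebesgue_integral_def mult.left_commute disjoint_family_on_def)
      qed
      ultimately show ?case by simp
    qed
  qed
  note intf = integrable_mult_bounded_on_interval[OF _ meas bound]
  from \<phi> show ?thesis
  proof (induction rule: integrable_induct)
    case (base S c)
    have "(\<lambda>n. c * (\<integral>x. indicator {a..b} x * (indicator S x * h n x) \<partial>lborel)) \<longlonglongrightarrow> 0"
      using set[of S] base by (intro tendsto_mult_right_zero) auto
    then show ?case by (simp add: ac_simps flip: integral_mult_right_zero)
  next
    case (add f g)
    then have "(\<lambda>n. (\<integral>x. indicator {a..b} x * (f x * h n x) \<partial>lborel)
      + (\<integral>x. indicator {a..b} x * (g x * h n x) \<partial>lborel)) \<longlonglongrightarrow> 0 + 0"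
      by (intro tendsto_add)
    then show ?case using intf[OF add.hyps(1)] intf[OF add.hyps(2)] by (simp add: algebra_simps)
  next
    case (lim f s)
    have [measurable]: "f \<in> borel_measurable borel" "s i \<in> borel_measurable borel" for i
      using borel_measurable_integrable[OF lim.hyps(4)] borel_measurable_integrable[OF lim.hyps(1)] by simp_all
    have diff: "integrable lborel (\<lambda>x. f x - s i x)" for i using lim by simp
    have "(\<lambda>i. \<integral>x. \<bar>f x - s i x\<bar> \<partial>lborel) \<longlonglongrightarrow> (\<integral>x. 0 \<partial>(lborel::real measure))"
    \<comment> \<open>The induction rule supplies approximants bounded by 2 * |f|; with f itself
      this makes 3.\<close>
    proof (rule integral_dominated_convergence[where w="\<lambda>x. 3 * \<bar>f x\<bar>"])
      have "(\<lambda>i. \<bar>f x - s i x\<bar>) \<longlonglongrightarrow> \<bar>f x - f x\<bar>" for x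
        using lim.hyps(2)[of x] by (intro tendsto_intros) auto
      then show "AE x in lborel. (\<lambda>i. \<bar>f x - s i x\<bar>) \<longlonglongrightarrow> 0" by simp
      have "\<bar>f x - s i x\<bar> \<le> 3 * \<bar>f x\<bar>" for i x using lim.hyps(3)[of x i] by simp
      then show "AE x in lborel. norm \<bar>f x - s i x\<bar> \<le> 3 * \<bar>f x\<bar>" for i by simp
    qed (use lim.hyps(4) in auto)
    then have L1: "(\<lambda>i. \<integral>x. \<bar>f x - s i x\<bar> \<partial>lborel) \<longlonglongrightarrow> 0" by simp
    show ?case
    proof (rule LIMSEQ_I)
      fix e :: real assume e: "0 < e"
      have "0 < e / (2 * (C + 1))" using e C by simp
      from LIMSEQ_D[OF L1 this] obtain i where "\<bar>\<integral>x. \<bar>f x - s i x\<bar> \<partial>lborel\<bar> < e / (2 * (C + 1))"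
        by auto
      then have i: "(\<integral>x. \<bar>f x - s i x\<bar> \<partial>lborel) < e / (2 * (C + 1))" by linarith
      have "C * (\<integral>x. \<bar>f x - s i x\<bar> \<partial>lborel) \<le> (C + 1) * (\<integral>x. \<bar>f x - s i x\<bar> \<partial>lborel)"
        by (intro mult_right_mono Bochner_Integration.integral_nonneg) auto
      also have "\<dots> < (C + 1) * (e / (2 * (C + 1)))" using i C by (intro mult_strict_left_mono) auto
      also have "\<dots> = e / 2" using C by (simp add: divide_simps)
      finally have small: "C * (\<integral>x. \<bar>f x - s i x\<bar> \<partial>lborel) < e / 2" .
      have diff_le: "\<bar>\<integral>x. indicator {a..b} x * ((f x - s i x) * h n x) \<partial>lborel\<bar> < e / 2" for n
      proof -
        have "\<bar>\<integral>x. indicator {a..b} x * ((f x - s i x) * h n x) \<partial>lborel\<bar>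
          \<le> (\<integral>x. \<bar>indicator {a..b} x * ((f x - s i x) * h n x)\<bar> \<partial>lborel)"
          by (rule integral_abs_bound)
        also have "\<dots> \<le> (\<integral>x. C * \<bar>f x - s i x\<bar> \<partial>lborel)"
        proof (rule integral_mono)
          fix x
          have "\<bar>f x - s i x\<bar> * \<bar>h n x\<bar> \<le> \<bar>f x - s i x\<bar> * C" using bound by (intro mult_left_mono) auto
          then show "\<bar>indicator {a..b} x * ((f x - s i x) * h n x)\<bar> \<le> C * \<bar>f x - s i x\<bar>"
            using C by (auto simp: indicator_def abs_mult mult.commute)
        qed (use intf[OF diff] diff in auto)
        also have "\<dots> = C * (\<integral>x. \<bar>f x - s i x\<bar> \<partial>lborel)" by simp
        finally show ?thesis using small by linarith
      qed
      obtain N where N: "\<And>n. N \<le> n \<Longrightarrow> \<bar>\<integral>x. indicator {a..b} x * (s i x * h n x) \<partial>lborel\<bar> < e / 2"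
        using LIMSEQ_D[OF lim.IH[of i], of "e / 2"] e by auto
      have split: "(\<integral>x. indicator {a..b} x * (f x * h n x) \<partial>lborel) = (\<integral>x. indicator {a..b} x * (s i x * h n x) \<partial>lborel)
        + (\<integral>x. indicator {a..b} x * ((f x - s i x) * h n x) \<partial>lborel)" for n
        by (subst Bochner_Integration.integral_add[symmetric, OF intf[OF lim.hyps(1)] intf[OF diff]])
           (simp add: algebra_simps)
      have "norm ((\<integral>x. indicator {a..b} x * (f x * h n x) \<partial>lborel) - 0) < e" if "N \<le> n" for n
        using N[OF that] diff_le[of n] unfolding split real_norm_def by linarith
      then show "\<exists>N. \<forall>n\<ge>N. norm ((\<integral>x. indicator {a..b} x * (f x * h n x) \<partial>lborel) - 0) < e" by blast
    qed
  qed
qed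

section \<open>Weak limits of the iterates\<close>

context triangular_cell
begin

lemma inner_w_iter_one:
  assumes "bounded_measurable f"
  shows "inner_w (iter f n) (\<lambda>_. 1) = inner_w f (\<lambda>_. 1)"
  by (induction n) (simp_all add: iter_0 iter_Suc inner_w_P_one bounded_measurable_iter assms)

text \<open>The means \<open>c n\<close> over the circle are not computed directly. The pairing of
  \<open>sym_iter s f n\<close> with \<open>w\<close> equals (1 + s) * inner_w f 1 for every n by
  stationarity, and asymptotically it is 2 * c n. For s = -1 the conserved pairing, and so the
  limit, is 0.\<close>

lemma sym_iter_weak_limit:
  assumes f: "bounded_measurable f" and irrational: "\<alpha> / (2*pi) \<notin> \<rat>"
    and \<phi>: "integrable lborel \<phi>" and s: "s = 1 \<or> s = -1"
  shows "(\<lambda>n. \<integral>x. indicator {0..pi} x * (\<phi> x * sym_iter s f n x) \<partial>lborel) \<longlonglongrightarrow>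
    (1 + s) * inner_w f (\<lambda>_. 1) / 2 * (\<integral>x. indicator {0..pi} x * \<phi> x \<partial>lborel)"
proof -
  obtain C where C: "\<And>x. \<bar>f x\<bar> \<le> C" using f by (auto simp: bounded_measurable_def)
  define G where "G n = circle_ext s (sym_iter s f n)" for n
  have bG: "bounded_measurable (G n)" for n
    unfolding G_def by (intro bounded_measurable_circle_ext bounded_measurable_sym_iter f)
  note [measurable] = bounded_measurableD[OF bG]
  have bound: "\<bar>G n x\<bar> \<le> 2 * C" for n x
    unfolding G_def by (intro circle_ext_bound sym_iter_bound C s)
  have per: "G n (x + 2*pi) = G n x" for n x unfolding G_def by (rule circle_ext_periodic)
  have one_step: "L1_null (\<lambda>n x. indicator {a..b} x * (G n (x + 2*\<alpha>) - s * G n x))" for a b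
  proof (rule L1_null_periodic_local)
    show "L1_null (\<lambda>n x. indicator {-pi..pi} x * (G n (x + 2*\<alpha>) - s * G n x))"
      unfolding G_def by (rule circle_ext_almost_invariant[OF f s])
    show "G n (x + 2*pi + 2*\<alpha>) - s * G n (x + 2*pi) = G n (x + 2*\<alpha>) - s * G n x" for n x
      using per[of n x] per[of n "x + 2*\<alpha>"] by (simp add: algebra_simps)
  qed measurable
  \<comment> \<open>One rotation by 2*\<alpha> multiplies by s; doing it twice removes the
    sign.\<close>
  have two_steps: "L1_null (\<lambda>n x. indicator {a..b} x * (G n (x + 4*\<alpha>) - G n x))" for a b
  proof -
    let ?e = "\<lambda>a b n x. indicator {a..b} x * (G n (x + 2*\<alpha>) - s * G n x)"
    have "L1_null (\<lambda>n x. \<bar>?e a b n x\<bar> + \<bar>?e (a + 2*\<alpha>) (b + 2*\<alpha>) n (2*\<alpha> + 1 * x)\<bar>)"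
      by (intro L1_null_abs_add one_step L1_null_affine[OF one_step]) simp
    then show ?thesis
    proof (rule L1_null_dominated)
      fix n
      have eq: "2*\<alpha> + 1 * x = x + 2*\<alpha>" "x + 2*\<alpha> + 2*\<alpha> = x + 4*\<alpha>" for x by simp_all
      have "\<bar>indicator {a..b} x * (G n (x + 4*\<alpha>) - G n x)\<bar>
        \<le> \<bar>\<bar>?e a b n x\<bar> + \<bar>?e (a + 2*\<alpha>) (b + 2*\<alpha>) n (2*\<alpha> + 1 * x)\<bar>\<bar>" for x
        unfolding eq using s by (elim disjE) (simp add: indicator_def; linarith)+
      then show "AE x in lborel. \<bar>indicator {a..b} x * (G n (x + 4*\<alpha>) - G n x)\<bar>
        \<le> \<bar>\<bar>?e a b n x\<bar> + \<bar>?e (a + 2*\<alpha>) (b + 2*\<alpha>) n (2*\<alpha> + 1 * x)\<bar>\<bar>" by simp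
    qed measurable
  qed
  define c where "c n = (\<integral>y. indicator {0..<2*pi} y * G n y \<partial>lborel) / (2*pi)" for n
  have "4*\<alpha> / (2*pi) \<notin> \<rat>"
  proof
    assume "4*\<alpha> / (2*pi) \<in> \<rat>"
    from Rats_divide[OF this, of 4] have "4*\<alpha> / (2*pi) / 4 \<in> \<rat>" by simp
    then show False using irrational by simp
  qed
  then have interval: "(\<lambda>n. \<integral>x. indicator {a..b} x * (G n x - c n) \<partial>lborel) \<longlonglongrightarrow> 0" for a b
    unfolding c_def by (intro weak_limit_rotation_invariant[of G "2*C" _ "4*\<alpha>"] bound per two_steps) auto
  have int: "integrable lborel (\<lambda>x. indicator {d..<e} x * k x)" if "bounded_measurable k" for d e k
    by (rule integrable_bounded_measurable[OF that, of _ d e]) (auto simp: indicator_def)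
  have c_bound: "\<bar>c n\<bar> \<le> 2 * C" for n
  proof -
    have "\<bar>\<integral>y. indicator {0..<2*pi} y * G n y \<partial>lborel\<bar> \<le> (\<integral>y. \<bar>indicator {0..<2*pi} y * G n y\<bar> \<partial>lborel)"
      by (rule integral_abs_bound)
    also have "\<dots> \<le> (\<integral>y. indicator {0..<2*pi} y * (2 * C) \<partial>lborel)"
      using bound by (intro integral_mono int Bochner_Integration.integrable_abs bounded_measurable_const bG)
        (auto simp: indicator_def)
    also have "\<dots> = 2 * C * (2*pi)" by simp
    finally show ?thesis by (simp add: c_def field_simps abs_mult)
  qed
  have weak: "(\<lambda>n. \<integral>x. indicator {0..pi} x * (\<psi> x * (G n x - c n)) \<partial>lborel) \<longlonglongrightarrow> 0"
    if "integrable lborel \<psi>" for \<psi>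
  proof (rule weak_null_integrable[OF _ _ interval that])
    show "\<bar>G n x - c n\<bar> \<le> 4 * C" for n x using bound[of n x] c_bound[of n] by linarith
  qed measurable
  note int_G = integrable_mult_bounded_on_interval[OF _ bounded_measurableD[OF bG] bound, of _ 0 pi]
  have int_ind: "integrable lborel (\<lambda>x. indicator {0..pi} x * \<psi> x)" if "integrable lborel \<psi>" for \<psi> :: "real \<Rightarrow> real"
    using integrable_mult_bounded_on_interval[OF that, of "\<lambda>_. 1" 1] by simp
  have expand: "(\<integral>x. indicator {0..pi} x * (\<psi> x * (G n x - c n)) \<partial>lborel)
    = (\<integral>x. indicator {0..pi} x * (\<psi> x * sym_iter s f n x) \<partial>lborel)
      - c n * (\<integral>x. indicator {0..pi} x * \<psi> x \<partial>lborel)" if "integrable lborel \<psi>" for \<psi> n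
  proof -
    have "(\<integral>x. indicator {0..pi} x * (\<psi> x * (G n x - c n)) \<partial>lborel)
      = (\<integral>x. indicator {0..pi} x * (\<psi> x * G n x) - c n * (indicator {0..pi} x * \<psi> x) \<partial>lborel)"
      by (simp add: algebra_simps)
    also have "\<dots> = (\<integral>x. indicator {0..pi} x * (\<psi> x * G n x) \<partial>lborel) - c n * (\<integral>x. indicator {0..pi} x * \<psi> x \<partial>lborel)"
      using int_G[OF that] int_ind[OF that] by simp
    also have "(\<integral>x. indicator {0..pi} x * (\<psi> x * G n x) \<partial>lborel)
      = (\<integral>x. indicator {0..pi} x * (\<psi> x * sym_iter s f n x) \<partial>lborel)"
      by (rule Bochner_Integration.integral_cong) (auto simp: G_def circle_ext_upper indicator_def)
    finally show ?thesis .
  qed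
  have w_int: "integrable lborel w" using w_integrable[OF bounded_measurable_const[of 1]] by simp
  have sin_int: "(\<integral>x. indicator {0..pi} x * w x \<partial>lborel) = 2"
  proof -
    have "(\<integral>x. sin x * indicator {0..pi} x \<partial>lborel) = - cos pi - - cos 0"
      by (rule integral_FTC_Icc_real) (auto intro!: derivative_eq_intros)
    moreover have "indicator {0..pi} x * w x = sin x * indicator {0..pi} x" for x
      by (auto simp: w_def indicator_def)
    ultimately show ?thesis by (simp only:) simp
  qed
  have sym_w: "(\<integral>x. indicator {0..pi} x * (w x * sym_iter s f n x) \<partial>lborel) = (1 + s) * inner_w f (\<lambda>_. 1)" for n
  proof -
    have "(\<integral>x. indicator {0..pi} x * (w x * sym_iter s f n x) \<partial>lborel) = inner_w (sym_iter s f n) (\<lambda>_. 1)"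
      unfolding inner_w_def by (rule Bochner_Integration.integral_cong) (auto simp: w_def indicator_def)
    also have "\<dots> = (1 + s) * inner_w f (\<lambda>_. 1)"
      unfolding sym_iter_def[abs_def]
      by (subst inner_w_add_left)
         (simp_all add: bounded_measurable_iter bounded_measurable_const f inner_w_iter_one algebra_simps)
    finally show ?thesis .
  qed
  \<comment> \<open>The inner bracket is the integral that tends to 0; the whole expression is
    \<open>c n\<close>, written so that the limit laws deliver its limit.\<close>
  have "(\<lambda>n. ((1 + s) * inner_w f (\<lambda>_. 1) - ((1 + s) * inner_w f (\<lambda>_. 1) - c n * 2)) / 2)
      \<longlonglongrightarrow> ((1 + s) * inner_w f (\<lambda>_. 1) - 0) / 2"
    using weak[OF w_int] unfolding expand[OF w_int] sym_w sin_int by (intro tendsto_intros) auto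
  then have c_lim: "c \<longlonglongrightarrow> (1 + s) * inner_w f (\<lambda>_. 1) / 2" by simp
  have "(\<lambda>n. (\<integral>x. indicator {0..pi} x * (\<phi> x * (G n x - c n)) \<partial>lborel)
      + c n * (\<integral>x. indicator {0..pi} x * \<phi> x \<partial>lborel)) \<longlonglongrightarrow>
    0 + (1 + s) * inner_w f (\<lambda>_. 1) / 2 * (\<integral>x. indicator {0..pi} x * \<phi> x \<partial>lborel)"
    by (intro tendsto_add tendsto_mult weak \<phi> c_lim tendsto_const)
  then show ?thesis unfolding expand[OF \<phi>] by simp
qed

lemma iter_weak_limit:
  assumes f: "bounded_measurable f" and irrational: "\<alpha> / (2*pi) \<notin> \<rat>"
    and \<phi>: "integrable lborel \<phi>"
  shows "(\<lambda>n. \<integral>x. indicator {0..pi} x * (\<phi> x * iter f n x) \<partial>lborel) \<longlonglongrightarrow>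
    inner_w f (\<lambda>_. 1) / 2 * (\<integral>x. indicator {0..pi} x * \<phi> x \<partial>lborel)"
proof -
  define I where "I s n = (\<integral>x. indicator {0..pi} x * (\<phi> x * sym_iter s f n x) \<partial>lborel)" for s n
  obtain C where C: "\<And>x. \<bar>f x\<bar> \<le> C" using f by (auto simp: bounded_measurable_def)
  have int: "integrable lborel (\<lambda>x. indicator {0..pi} x * (\<phi> x * sym_iter s f n x))" if "s = 1 \<or> s = -1" for s n
    by (intro integrable_mult_bounded_on_interval[where C="2*C"] \<phi> bounded_measurableD
        bounded_measurable_sym_iter f sym_iter_bound C that)
  have eq: "(\<integral>x. indicator {0..pi} x * (\<phi> x * iter f n x) \<partial>lborel) = (I 1 n + I (-1) n) / 2" for n
  proof -
    have "I 1 n + I (-1) n = (\<integral>x. 2 * (indicator {0..pi} x * (\<phi> x * iter f n x)) \<partial>lborel)"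
      unfolding I_def
      by (subst Bochner_Integration.integral_add[symmetric, OF int int])
         (auto intro!: Bochner_Integration.integral_cong simp: sym_iter_def algebra_simps)
    then show ?thesis by simp
  qed
  have "(\<lambda>n. (I 1 n + I (-1) n) / 2) \<longlonglongrightarrow>
    ((1 + 1) * inner_w f (\<lambda>_. 1) / 2 * (\<integral>x. indicator {0..pi} x * \<phi> x \<partial>lborel)
    + (1 + -1) * inner_w f (\<lambda>_. 1) / 2 * (\<integral>x. indicator {0..pi} x * \<phi> x \<partial>lborel)) / 2"
    unfolding I_def by (intro tendsto_intros sym_iter_weak_limit f irrational \<phi>) auto
  then show ?thesis unfolding eq by simp
qed

end

section \<open>Iterates of the kernel\<close>

lemma borel_measurable_restricted_sets:
  assumes "sets M = sets (restrict_space borel {0..pi})" "f \<in> borel_measurable borel"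
  shows "f \<in> borel_measurable M"
  using measurable_restrict_space1[OF assms(2)] measurable_cong_sets[OF assms(1) refl] by blast

section \<open>Duality between the kernel and the transition operator\<close>

context triangular_cell
begin

text \<open>For indicators this is the value of the kernel measure on
  \<open>A \<inter> {0..pi}\<close>, and the general case is monotone approximation. The indicators
  of [0,pi] record that \<open>kernel_step\<close> lives on that space; they are absorbed as soon as
  f vanishes outside.\<close>

lemma nn_integral_kernel_step:
  fixes f :: "real \<Rightarrow> ennreal"
  assumes M: "sets M = sets (restrict_space borel {0..pi})" and f: "f \<in> borel_measurable borel"
  shows "(\<integral>\<^sup>+x. f x \<partial>kernel_step \<alpha> M) = (\<integral>\<^sup>+\<theta>.
      ennreal (p1 \<alpha> \<theta>) * (f (tau1 \<alpha> \<theta>) * indicator {0..pi} (tau1 \<alpha> \<theta>))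
    + ennreal (p2 \<alpha> \<theta>) * (f (tau2 \<alpha> \<theta>) * indicator {0..pi} (tau2 \<alpha> \<theta>))
    + ennreal (p3 \<alpha> \<theta>) * (f (tau3 \<alpha> \<theta>) * indicator {0..pi} (tau3 \<alpha> \<theta>))
    + ennreal (p4 \<alpha> \<theta>) * (f (tau4 \<alpha> \<theta>) * indicator {0..pi} (tau4 \<alpha> \<theta>)) \<partial>M)"
    (is "_ = (\<integral>\<^sup>+\<theta>. ?Q f \<theta> \<partial>M)")
proof -
  have space_M: "space M = {0..pi}"
    using sets_eq_imp_space_eq[OF M] by (simp add: space_restrict_space)
  have meas_step: "g \<in> borel_measurable (kernel_step \<alpha> M)" if "g \<in> borel_measurable borel" for g :: "real \<Rightarrow> ennreal"
    using that by (rule borel_measurable_restricted_sets[OF sets_kernel_step])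
  have meas_Q: "?Q g \<in> borel_measurable M" if [measurable]: "g \<in> borel_measurable borel" for g
    by (rule borel_measurable_restricted_sets[OF M]) measurable
  from f show ?thesis
  proof (induction rule: borel_measurable_induct)
    case (cong f g)
    then have "f = g" by auto
    then show ?case using cong by simp
  next
    case (set A)
    have A: "A \<inter> {0..pi} \<in> sets (restrict_space borel {0..pi})"
      using set by (auto simp: sets_restrict_space)
    have "(\<integral>\<^sup>+x. indicator A x \<partial>kernel_step \<alpha> M) = emeasure (kernel_step \<alpha> M) (A \<inter> {0..pi})"
      using nn_integral_indicator'[of A "kernel_step \<alpha> M"] A
      by (simp add: space_kernel_step sets_kernel_step)
    also have "\<dots> = (\<integral>\<^sup>+\<theta>. ennreal (K \<alpha> \<theta> (A \<inter> {0..pi})) \<partial>M)"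
      by (rule emeasure_kernel_step[OF \<alpha>_pos \<alpha>_less M A])
    also have "\<dots> = (\<integral>\<^sup>+\<theta>. ?Q (indicator A) \<theta> \<partial>M)"
      by (rule nn_integral_cong)
         (simp add: space_M ennreal_K_eq[OF \<alpha>_pos \<alpha>_less] indicator_inter_arith)
    finally show ?case .
  next
    case (mult f c)
    have "?Q (\<lambda>x. c * f x) \<theta> = c * ?Q f \<theta>" for \<theta>
      by (simp add: distrib_left mult.left_commute mult.assoc)
    then show ?case
      using mult by (simp add: nn_integral_cmult meas_step meas_Q)
  next
    case (add f g)
    have "?Q (\<lambda>x. g x + f x) \<theta> = ?Q g \<theta> + ?Q f \<theta>" for \<theta>
      by (simp add: distrib_left distrib_right ac_simps)
    then show ?case
      using add by (simp add: nn_integral_add meas_step meas_Q)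
  next
    case (seq U)
    have mono: "incseq (\<lambda>i. ?Q (U i))"
      using seq(3) by (auto simp: incseq_def le_fun_def intro!: add_mono mult_left_mono mult_right_mono)
    have Q_SUP: "?Q (\<lambda>x. SUP i. U i x) \<theta> = (SUP i. ?Q (U i) \<theta>)" for \<theta>
    proof -
      have inc: "incseq (\<lambda>i. ennreal p * (U i y * indicator {0..pi} y))" for p y
        using seq(3) by (auto simp: incseq_def le_fun_def intro!: mult_left_mono mult_right_mono)
      have sup: "ennreal p * ((SUP i. U i y) * indicator {0..pi} y)
        = (SUP i. ennreal p * (U i y * indicator {0..pi} y))" for p y
        by (simp add: SUP_mult_left_ennreal SUP_mult_right_ennreal)
      have inc_add: "incseq (\<lambda>i. a i + b i)" if "incseq a" "incseq b" for a b :: "nat \<Rightarrow> ennreal"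
        using that by (auto simp: incseq_def intro: add_mono)
      show ?thesis
        unfolding sup by (simp add: ennreal_SUP_add inc inc_add)
    qed
    have "(\<integral>\<^sup>+x. (SUP i. U i x) \<partial>kernel_step \<alpha> M) = (SUP i. \<integral>\<^sup>+x. U i x \<partial>kernel_step \<alpha> M)"
      by (intro nn_integral_monotone_convergence_SUP seq meas_step)
    also have "\<dots> = (SUP i. \<integral>\<^sup>+\<theta>. ?Q (U i) \<theta> \<partial>M)" using seq by simp
    also have "\<dots> = (\<integral>\<^sup>+\<theta>. (SUP i. ?Q (U i) \<theta>) \<partial>M)"
      by (intro nn_integral_monotone_convergence_SUP[symmetric] mono meas_Q seq)
    also have "\<dots> = (\<integral>\<^sup>+\<theta>. ?Q (\<lambda>x. SUP i. U i x) \<theta> \<partial>M)" by (simp only: Q_SUP)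
    finally show ?case using seq by (simp add: image_comp)
  qed
qed

lemma nn_integral_kernel_step_P:
  assumes M: "sets M = sets (restrict_space borel {0..pi})"
    and f: "f \<in> borel_measurable borel" "\<And>x. 0 \<le> f x" "\<And>x. x \<notin> {0..pi} \<Longrightarrow> f x = 0"
  shows "(\<integral>\<^sup>+x. ennreal (f x) \<partial>kernel_step \<alpha> M) = (\<integral>\<^sup>+x. ennreal (P f x) \<partial>M)"
proof -
  have space_M: "space M = {0..pi}"
    using sets_eq_imp_space_eq[OF M] by (simp add: space_restrict_space)
  have f_ind: "ennreal (f x) * indicator {0..pi} x = ennreal (f x)" for x
    using f(3)[of x] by (cases "x \<in> {0..pi}") auto
  have meas: "(\<lambda>x. ennreal (f x)) \<in> borel_measurable borel" using f(1) by measurable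
  show ?thesis
    unfolding nn_integral_kernel_step[OF M meas] f_ind
  proof (rule nn_integral_cong)
    fix \<theta> assume "\<theta> \<in> space M"
    then have \<theta>: "\<theta> \<in> {0..pi}" by (simp add: space_M)
    note n = p_nonneg[OF \<alpha>_pos \<alpha>_less \<theta>]
    have arg: "2*pi - 4*\<alpha> - \<theta> = tau2 \<alpha> \<theta>" "\<theta> + 2*\<alpha> = tau1 \<alpha> \<theta>" "\<theta> - 2*\<alpha> = tau3 \<alpha> \<theta>" "4*\<alpha> - \<theta> = tau4 \<alpha> \<theta>"
      by (simp_all add: tau1_def tau2_def tau3_def tau4_def)
    show "ennreal (p1 \<alpha> \<theta>) * ennreal (f (tau1 \<alpha> \<theta>)) + ennreal (p2 \<alpha> \<theta>) * ennreal (f (tau2 \<alpha> \<theta>))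
      + ennreal (p3 \<alpha> \<theta>) * ennreal (f (tau3 \<alpha> \<theta>)) + ennreal (p4 \<alpha> \<theta>) * ennreal (f (tau4 \<alpha> \<theta>))
      = ennreal (P f \<theta>)"
      using n f(2) \<theta> unfolding P_def arg
      by (simp add: ennreal_mult[symmetric] ennreal_plus[symmetric] del: ennreal_plus)
  qed
qed

lemma P_nonneg: "(\<And>x. 0 \<le> f x) \<Longrightarrow> 0 \<le> P f x"
  using p_nonneg[OF \<alpha>_pos \<alpha>_less, of x] by (cases "x \<in> {0..pi}") (auto simp: P_def)

lemma P_support: "x \<notin> {0..pi} \<Longrightarrow> P f x = 0"
  by (simp add: P_def)

lemma sets_kernel_iterate:
  assumes "sets \<nu> = sets (restrict_space borel {0..pi})"
  shows "sets (kernel_iterate \<alpha> \<nu> n) = sets (restrict_space borel {0..pi})"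
  using assms by (cases n) (simp_all add: sets_kernel_step)

lemma nn_integral_kernel_iterate:
  assumes \<nu>: "sets \<nu> = sets (restrict_space borel {0..pi})"
    and f: "f \<in> borel_measurable borel" "\<And>x. 0 \<le> f x" "\<And>x. x \<notin> {0..pi} \<Longrightarrow> f x = 0"
  shows "(\<integral>\<^sup>+x. ennreal (f x) \<partial>kernel_iterate \<alpha> \<nu> n) = (\<integral>\<^sup>+x. ennreal (iter f n x) \<partial>\<nu>)"
  using f
proof (induction n arbitrary: f)
  case 0
  then show ?case by (simp add: iter_0)
next
  case (Suc n)
  \<comment> \<open>Peeling off the last kernel step turns f into P f on the inside, whereas
    \<open>iter\<close> grows on the outside; hence the induction over arbitrary f in a class that P
    preserves.\<close>
  have "iter f (Suc n) = iter (P f) n" by (simp add: iter_def funpow_swap1)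
  moreover have "(\<integral>\<^sup>+x. ennreal (f x) \<partial>kernel_iterate \<alpha> \<nu> (Suc n)) = (\<integral>\<^sup>+x. ennreal (P f x) \<partial>kernel_iterate \<alpha> \<nu> n)"
    using nn_integral_kernel_step_P[OF sets_kernel_iterate[OF \<nu>] Suc.prems] by simp
  moreover have "\<dots> = (\<integral>\<^sup>+x. ennreal (iter (P f) n x) \<partial>\<nu>)"
    using Suc.prems by (intro Suc.IH P_measurable P_nonneg P_support)
  ultimately show ?case by simp
qed

lemma iter_nonneg: "(\<And>x. 0 \<le> f x) \<Longrightarrow> 0 \<le> iter f n x"
  by (induction n arbitrary: x) (auto simp: iter_0 iter_Suc P_nonneg)

end

text \<open>Radon-Nikodym gives an extended-valued density on the restricted space. Extended by zero
  it lives on the line, and total mass 1 makes it finite almost everywhere.\<close>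

lemma density_on_Icc:
  assumes "prob_space \<nu>" and sets_\<nu>: "sets \<nu> = sets (restrict_space borel {0..pi})"
    and ac: "absolutely_continuous (restrict_space lborel {0..pi}) \<nu>"
  obtains \<phi> where "integrable lborel \<phi>" "\<And>x. 0 \<le> \<phi> x" "(\<integral>x. indicator {0..pi} x * \<phi> x \<partial>lborel) = 1"
    "\<And>h. h \<in> borel_measurable borel \<Longrightarrow>
      (\<integral>\<^sup>+x. h x \<partial>\<nu>) = (\<integral>\<^sup>+x. ennreal (indicator {0..pi} x * \<phi> x) * h x \<partial>lborel)"
proof -
  interpret prob_space \<nu> by fact
  have fin: "finite_measure (restrict_space lborel {0..pi})"
    by (intro finite_measureI) (simp add: emeasure_restrict_space space_restrict_space)
  interpret L: finite_measure "restrict_space lborel {0..pi}" by (rule fin)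
  obtain g where g: "g \<in> borel_measurable (restrict_space lborel {0..pi})"
    and \<nu>: "density (restrict_space lborel {0..pi}) g = \<nu>"
    using L.Radon_Nikodym[OF ac] sets_\<nu> by (auto simp: sets_restrict_space)
  define k where "k x = g x * indicator {0..pi} x" for x
  have k [measurable]: "k \<in> borel_measurable borel"
    using g borel_measurable_restrict_space_iff_ennreal[of "{0..pi}" lborel g] by (simp add: k_def[abs_def])
  have nn: "(\<integral>\<^sup>+x. h x \<partial>\<nu>) = (\<integral>\<^sup>+x. k x * h x \<partial>lborel)" if [measurable]: "h \<in> borel_measurable borel" for h
  proof -
    have "(\<integral>\<^sup>+x. h x \<partial>\<nu>) = (\<integral>\<^sup>+x. g x * h x \<partial>restrict_space lborel {0..pi})"
      unfolding \<nu>[symmetric] using g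
      by (intro nn_integral_density) (auto intro: measurable_restrict_space1)
    also have "\<dots> = (\<integral>\<^sup>+x. k x * h x \<partial>lborel)"
      by (simp add: nn_integral_restrict_space k_def ac_simps)
    finally show ?thesis .
  qed
  have total: "(\<integral>\<^sup>+x. k x \<partial>lborel) = 1"
    using nn[of "\<lambda>_. 1"] emeasure_space_1 by simp
  then have finite: "AE x in lborel. k x \<noteq> \<infinity>" by (intro nn_integral_PInf_AE) auto
  \<comment> \<open>\<open>enn2real\<close> sends infinity to 0, which changes the density on a null
    set only.\<close>
  define \<phi> where "\<phi> x = enn2real (k x)" for x
  have \<phi>_k: "AE x in lborel. ennreal (indicator {0..pi} x * \<phi> x) = k x"
    using finite by eventually_elim (auto simp: \<phi>_def k_def indicator_def less_top)
  have ind: "indicator {0..pi} x * \<phi> x = \<phi> x" for x by (auto simp: \<phi>_def k_def indicator_def)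
  have [measurable]: "\<phi> \<in> borel_measurable borel" unfolding \<phi>_def[abs_def] by measurable
  have \<phi>_total: "(\<integral>\<^sup>+x. ennreal (\<phi> x) \<partial>lborel) = 1"
    using nn_integral_cong_AE[OF \<phi>_k] total by (simp add: ind)
  have \<phi>_nonneg: "0 \<le> \<phi> x" for x by (simp add: \<phi>_def)
  show ?thesis
  proof (rule that[of \<phi>])
    show "integrable lborel \<phi>"
      using \<phi>_total \<phi>_nonneg by (intro integrableI_nonneg) auto
    show "(\<integral>x. indicator {0..pi} x * \<phi> x \<partial>lborel) = 1"
      unfolding ind using \<phi>_total \<phi>_nonneg by (simp add: integral_eq_nn_integral)
    show "(\<integral>\<^sup>+x. h x \<partial>\<nu>) = (\<integral>\<^sup>+x. ennreal (indicator {0..pi} x * \<phi> x) * h x \<partial>lborel)"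
      if "h \<in> borel_measurable borel" for h
      unfolding nn[OF that] using \<phi>_k by (intro nn_integral_cong_AE) auto
  qed (rule \<phi>_nonneg)
qed

theorem mainTheorem2:
  fixes \<alpha> :: real and \<nu> :: "real measure" and A :: "real set"
  assumes "0 < \<alpha>" and "\<alpha> < pi / 6"
    and "\<alpha> / (2 * pi) \<notin> \<rat>"
    and "prob_space \<nu>"
    and "sets \<nu> = sets (restrict_space borel {0..pi})"
    and "absolutely_continuous (restrict_space lborel {0..pi}) \<nu>"
    and "A \<in> sets (restrict_space borel {0..pi})"
  shows "(\<lambda>n. measure (kernel_iterate \<alpha> \<nu> n) A)
           \<longlonglongrightarrow> 1/2 * (LINT \<theta>:A|lborel. sin \<theta>)"
proof -
  interpret triangular_cell \<alpha> by unfold_locales (use assms in auto)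
  define f :: "real \<Rightarrow> real" where "f = indicator A"
  have A: "A \<in> sets borel" "A \<subseteq> {0..pi}"
    using assms(7) sets_restrict_Icc_Pow by (auto simp: sets_restrict_space_iff)
  have f: "bounded_measurable f" "\<And>x. 0 \<le> f x" "\<And>x. x \<notin> {0..pi} \<Longrightarrow> f x = 0"
    using A by (auto simp: f_def indicator_def intro!: bounded_measurableI[of _ 1])
  obtain \<phi> where \<phi>: "integrable lborel \<phi>" "\<And>x. 0 \<le> \<phi> x" "(\<integral>x. indicator {0..pi} x * \<phi> x \<partial>lborel) = 1"
    and density: "\<And>h. h \<in> borel_measurable borel \<Longrightarrow>
      (\<integral>\<^sup>+x. h x \<partial>\<nu>) = (\<integral>\<^sup>+x. ennreal (indicator {0..pi} x * \<phi> x) * h x \<partial>lborel)"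
    using density_on_Icc[OF assms(4-6)] by blast
  note bm = bounded_measurable_iter[OF f(1)]
  \<comment> \<open>Duality: the mass of A after n steps is the pairing of the initial density with
    P^n applied to the indicator of A, so the weak limit applies with \<phi> as the test
    function.\<close>
  have "measure (kernel_iterate \<alpha> \<nu> n) A = (\<integral>x. indicator {0..pi} x * (\<phi> x * iter f n x) \<partial>lborel)" for n
  proof -
    have nonneg: "0 \<le> indicator {0..pi} x * (\<phi> x * iter f n x)" for x
      using \<phi>(2) iter_nonneg[OF f(2)] by simp
    have [measurable]: "iter f n \<in> borel_measurable borel" "\<phi> \<in> borel_measurable borel"
      using bounded_measurableD[OF bm] borel_measurable_integrable[OF \<phi>(1)] by auto
    have "emeasure (kernel_iterate \<alpha> \<nu> n) A = (\<integral>\<^sup>+x. ennreal (f x) \<partial>kernel_iterate \<alpha> \<nu> n)"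
      using assms(7) sets_kernel_iterate[OF assms(5), of n] by (simp add: f_def ennreal_indicator)
    also have "\<dots> = (\<integral>\<^sup>+x. ennreal (iter f n x) \<partial>\<nu>)"
      by (rule nn_integral_kernel_iterate[OF assms(5) bounded_measurableD[OF f(1)] f(2,3)])
    also have "\<dots> = (\<integral>\<^sup>+x. ennreal (indicator {0..pi} x * \<phi> x) * ennreal (iter f n x) \<partial>lborel)"
      by (rule density) measurable
    also have "\<dots> = (\<integral>\<^sup>+x. ennreal (indicator {0..pi} x * (\<phi> x * iter f n x)) \<partial>lborel)"
      using \<phi>(2) iter_nonneg[OF f(2)] by (simp add: ennreal_mult[symmetric] mult.assoc)
    finally have "measure (kernel_iterate \<alpha> \<nu> n) A
      = enn2real (\<integral>\<^sup>+x. ennreal (indicator {0..pi} x * (\<phi> x * iter f n x)) \<partial>lborel)"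
      by (simp add: measure_def)
    then show ?thesis using nonneg by (simp add: integral_eq_nn_integral)
  qed
  moreover have "inner_w f (\<lambda>_. 1) = (LINT \<theta>:A|lborel. sin \<theta>)"
    unfolding inner_w_def set_lebesgue_integral_def
    using A(2) by (intro Bochner_Integration.integral_cong) (auto simp: w_def f_def indicator_def)
  ultimately show ?thesis
    using iter_weak_limit[OF f(1) assms(3) \<phi>(1)] \<phi>(3) by simp
qed

end
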